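(* Let $n\ge 1$ and let $g$ be the Semi-Riemannian metric on $GL_n=GL_n(\mathbb{R})$ given by $g_A(V,W)=\mathrm{tr}(A^{-1}VA^{-1}W)$ for $A\in GL_n$, $V,W\in T_A(GL_n)=M_n(\mathbb{R})$; denote also by $g$ its restriction to $SL_n=SL_n(\mathbb{R})$. Then $(SL_n,g)$ is a totally geodesic Semi-Riemannian submanifold of $(GL_n,g)$. The geodesics of $(SL_n,g)$ are precisely the curves of the type $P(t)=Ke^{tC}$ with $K,C\in M_n(\mathbb{R})$, $\det(K)=1$ and $\mathrm{tr}(C)=0$, and $(SL_n,g)$ is geodesically complete.
   Context: $SL_n(\mathbb{R})$ is the group of real $n\times n$ matrices of determinant $1$. Geodesics are understood as maximal ones, and constant curves are regarded as geodesics. *)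

theory Defs
  imports "HOL-Analysis.Analysis"
begin

text \<open>All manifolds here are embedded submanifolds of a Euclidean space (for the theorem, the
  space of real \<open>n \<times> n\<close> matrices); open subsets, such as the general linear group, are the
  full-dimensional case.\<close>

section \<open>Smooth maps\<close>

text \<open>For \<open>U\<close> open and a Euclidean domain this is the usual class of \<open>k\<close> times continuously
  differentiable maps.\<close>

primrec Ck_on ::
  "nat \<Rightarrow> 'a::real_normed_vector set \<Rightarrow> ('a \<Rightarrow> 'b::real_normed_vector) \<Rightarrow> bool" where
  "Ck_on 0 U f \<longleftrightarrow> continuous_on U f"
| "Ck_on (Suc k) U f \<longleftrightarrow>
     (\<forall>x\<in>U. f differentiable (at x)) \<and> (\<forall>v. Ck_on k U (\<lambda>x. frechet_derivative f (at x) v))"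

text \<open>Smoothness on an arbitrary subset means the existence of local smooth extensions to open
  sets. On an open set this is ordinary smoothness, on an embedded submanifold it is smoothness
  in charts.\<close>

definition smooth_on ::
  "'a::real_normed_vector set \<Rightarrow> ('a \<Rightarrow> 'b::real_normed_vector) \<Rightarrow> bool" where
  "smooth_on S f \<longleftrightarrow>
     (\<forall>p\<in>S. \<exists>N F. open N \<and> p \<in> N \<and> (\<forall>k. Ck_on k N F) \<and> (\<forall>x\<in>N \<inter> S. F x = f x))"

section \<open>Embedded submanifolds\<close>

text \<open>A slice chart: a diffeomorphism \<open>\<phi>\<close> between open sets \<open>W\<close> and \<open>V\<close>, with inverse \<open>\<psi>\<close>,
  straightening \<open>S\<close> to the linear subspace \<open>H\<close>. Its restriction to \<open>W \<inter> S\<close> is a chart of \<open>S\<close>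
  with values in \<open>V \<inter> H\<close>. Working with a subspace \<open>H\<close> also covers manifolds of dimension 0.\<close>

definition slice_chart ::
  "'a::euclidean_space set \<Rightarrow> 'a set \<Rightarrow> 'a set \<Rightarrow> 'a set \<Rightarrow> ('a \<Rightarrow> 'a) \<Rightarrow> ('a \<Rightarrow> 'a) \<Rightarrow> bool" where
  "slice_chart S H W V \<phi> \<psi> \<longleftrightarrow>
     subspace H \<and> open W \<and> open V \<and> homeomorphism W V \<phi> \<psi> \<and>
     smooth_on W \<phi> \<and> smooth_on V \<psi> \<and> \<phi> ` (W \<inter> S) = V \<inter> H"

definition embedded_submanifold :: "'a::euclidean_space set \<Rightarrow> bool" where
  "embedded_submanifold S \<longleftrightarrow>
     (\<exists>d. \<forall>p\<in>S. \<exists>H W V \<phi> \<psi>. slice_chart S H W V \<phi> \<psi> \<and> p \<in> W \<and> dim H = d)"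

definition tangent_space :: "'a::euclidean_space set \<Rightarrow> 'a \<Rightarrow> 'a set" where
  "tangent_space S p =
     {v. \<exists>e>0. \<exists>\<gamma>. smooth_on {-e<..<e} \<gamma> \<and> \<gamma> ` {-e<..<e} \<subseteq> S \<and> \<gamma> (0::real) = p \<and>
           (\<gamma> has_vector_derivative v) (at 0)}"

definition tangent_field :: "'a::euclidean_space set \<Rightarrow> ('a \<Rightarrow> 'a) \<Rightarrow> bool" where
  "tangent_field S X \<longleftrightarrow> smooth_on S X \<and> (\<forall>p\<in>S. X p \<in> tangent_space S p)"

section \<open>Metric tensors\<close>

definition form_index :: "'a::euclidean_space set \<Rightarrow> ('a \<Rightarrow> 'a \<Rightarrow> real) \<Rightarrow> nat" where
  "form_index T b = Max {dim F | F. subspace F \<and> F \<subseteq> T \<and> (\<forall>v\<in>F. v \<noteq> 0 \<longrightarrow> b v v < 0)}"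

text \<open>Only the values \<open>g p v w\<close> with \<open>p \<in> S\<close> and \<open>v\<close>, \<open>w\<close> tangent to \<open>S\<close> at \<open>p\<close> matter, so passing
  from \<open>g\<close> to its restriction to a submanifold amounts to changing \<open>S\<close>.\<close>

definition metric_tensor ::
  "'a::euclidean_space set \<Rightarrow> ('a \<Rightarrow> 'a \<Rightarrow> 'a \<Rightarrow> real) \<Rightarrow> bool" where
  "metric_tensor S g \<longleftrightarrow>
     (\<forall>p\<in>S. \<forall>u\<in>tangent_space S p. \<forall>v\<in>tangent_space S p. \<forall>w\<in>tangent_space S p. \<forall>a.
        g p (u + a *\<^sub>R v) w = g p u w + a * g p v w) \<and>
     (\<forall>p\<in>S. \<forall>v\<in>tangent_space S p. \<forall>w\<in>tangent_space S p. g p v w = g p w v) \<and>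
     (\<forall>p\<in>S. \<forall>v\<in>tangent_space S p. (\<forall>w\<in>tangent_space S p. g p v w = 0) \<longrightarrow> v = 0) \<and>
     (\<forall>X Y. tangent_field S X \<and> tangent_field S Y \<longrightarrow> smooth_on S (\<lambda>p. g p (X p) (Y p))) \<and>
     (\<exists>\<nu>. \<forall>p\<in>S. form_index (tangent_space S p) (g p) = \<nu>)"

definition semi_riemannian_manifold ::
  "'a::euclidean_space set \<Rightarrow> ('a \<Rightarrow> 'a \<Rightarrow> 'a \<Rightarrow> real) \<Rightarrow> bool" where
  "semi_riemannian_manifold S g \<longleftrightarrow> embedded_submanifold S \<and> metric_tensor S g"

definition semi_riemannian_submanifold ::
  "'a::euclidean_space set \<Rightarrow> 'a set \<Rightarrow> ('a \<Rightarrow> 'a \<Rightarrow> 'a \<Rightarrow> real) \<Rightarrow> bool" where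
  "semi_riemannian_submanifold S M g \<longleftrightarrow>
     S \<subseteq> M \<and> semi_riemannian_manifold M g \<and> semi_riemannian_manifold S g"

section \<open>Levi-Civita connection\<close>

text \<open>Let \<open>h\<close> be a metric tensor on a relatively open subset of the linear space \<open>H\<close> containing
  \<open>x\<close>. In linear coordinates a connection on that set has the form
  \<open>\<nabla>\<^sub>X Y = DY(X) + \<Gamma>(X,Y)\<close>. It is torsion-free iff \<open>\<Gamma>\<close> is symmetric, and it is
  compatible with \<open>h\<close> iff the last condition below holds.
  By the Koszul formula and nondegeneracy, these conditions determine \<open>\<Gamma>\<close> uniquely on \<open>H\<close> (and
  make it bilinear there); its values off \<open>H\<close> are irrelevant.\<close>

definition levi_civita_form ::
  "'a::euclidean_space set \<Rightarrow> ('a \<Rightarrow> 'a \<Rightarrow> 'a \<Rightarrow> real) \<Rightarrow> 'a \<Rightarrow> ('a \<Rightarrow> 'a \<Rightarrow> 'a) \<Rightarrow> bool" where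
  "levi_civita_form H h x \<Gamma> \<longleftrightarrow>
     (\<forall>v\<in>H. \<forall>w\<in>H. \<Gamma> v w \<in> H) \<and>
     (\<forall>v\<in>H. \<forall>w\<in>H. \<Gamma> v w = \<Gamma> w v) \<and>
     (\<forall>u\<in>H. \<forall>v\<in>H. \<forall>w\<in>H.
        deriv (\<lambda>s. h (x + s *\<^sub>R u) v w) 0 = h x (\<Gamma> u v) w + h x v (\<Gamma> u w))"

definition christoffel ::
  "'a::euclidean_space set \<Rightarrow> ('a \<Rightarrow> 'a \<Rightarrow> 'a \<Rightarrow> real) \<Rightarrow> 'a \<Rightarrow> 'a \<Rightarrow> 'a \<Rightarrow> 'a" where
  "christoffel H h x = (SOME \<Gamma>. levi_civita_form H h x \<Gamma>)"

text \<open>The covariant derivative of \<open>Y\<close> along \<open>X\<close> on an open subset of the Euclidean space.\<close>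

definition cov_deriv ::
  "('a::euclidean_space \<Rightarrow> 'a \<Rightarrow> 'a \<Rightarrow> real) \<Rightarrow> ('a \<Rightarrow> 'a) \<Rightarrow> ('a \<Rightarrow> 'a) \<Rightarrow> 'a \<Rightarrow> 'a" where
  "cov_deriv g X Y p = frechet_derivative Y (at p) (X p) + christoffel UNIV g p (X p) (Y p)"

section \<open>Totally geodesic submanifolds\<close>

definition normal_part ::
  "'a::euclidean_space set \<Rightarrow> ('a \<Rightarrow> 'a \<Rightarrow> 'a \<Rightarrow> real) \<Rightarrow> 'a \<Rightarrow> 'a \<Rightarrow> 'a" where
  "normal_part S g p x =
     (THE z. (\<forall>w\<in>tangent_space S p. g p z w = 0) \<and> x - z \<in> tangent_space S p)"

definition second_fundamental_form ::
  "'a::euclidean_space set \<Rightarrow> ('a \<Rightarrow> 'a \<Rightarrow> 'a \<Rightarrow> real) \<Rightarrow> ('a \<Rightarrow> 'a) \<Rightarrow> ('a \<Rightarrow> 'a) \<Rightarrow> 'a \<Rightarrow> 'a" where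
  "second_fundamental_form S g X Y p = normal_part S g p (cov_deriv g X Y p)"

text \<open>The second fundamental form is computed from local extensions \<open>X\<close>, \<open>Y\<close> of tangent fields
  of \<open>S\<close> to open subsets \<open>N\<close> of the ambient manifold \<open>M\<close>. The ambient manifold is required to be
  open in the Euclidean space, as \<^const>\<open>cov_deriv\<close> is its connection only in that case.\<close>

definition totally_geodesic_submanifold ::
  "'a::euclidean_space set \<Rightarrow> 'a set \<Rightarrow> ('a \<Rightarrow> 'a \<Rightarrow> 'a \<Rightarrow> real) \<Rightarrow> bool" where
  "totally_geodesic_submanifold S M g \<longleftrightarrow>
     open M \<and> semi_riemannian_submanifold S M g \<and>
     (\<forall>N X Y. open N \<and> N \<subseteq> M \<and> smooth_on N X \<and> smooth_on N Y \<and>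
        tangent_field (N \<inter> S) X \<and> tangent_field (N \<inter> S) Y \<longrightarrow>
        (\<forall>p\<in>N \<inter> S. second_fundamental_form S g X Y p = 0))"

section \<open>Geodesics\<close>

text \<open>The pullback of \<open>g\<close> under the inverse \<open>\<psi>\<close> of a slice chart.\<close>

definition pullback_metric ::
  "('a::euclidean_space \<Rightarrow> 'a \<Rightarrow> 'a \<Rightarrow> real) \<Rightarrow> ('a \<Rightarrow> 'a) \<Rightarrow> 'a \<Rightarrow> 'a \<Rightarrow> 'a \<Rightarrow> real" where
  "pullback_metric g \<psi> y u v =
     g (\<psi> y) (frechet_derivative \<psi> (at y) u) (frechet_derivative \<psi> (at y) v)"

text \<open>\<open>c'' + \<Gamma>(c', c') = 0\<close> at time \<open>t\<close>, for a curve \<open>c\<close> in \<open>H\<close> with metric tensor \<open>h\<close>.\<close>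

definition geodesic_equation_at ::
  "'a::euclidean_space set \<Rightarrow> ('a \<Rightarrow> 'a \<Rightarrow> 'a \<Rightarrow> real) \<Rightarrow> (real \<Rightarrow> 'a) \<Rightarrow> real \<Rightarrow> bool" where
  "geodesic_equation_at H h c t \<longleftrightarrow>
     vector_derivative (\<lambda>s. vector_derivative c (at s)) (at t) +
     christoffel H h (c t) (vector_derivative c (at t)) (vector_derivative c (at t)) = 0"

text \<open>A geodesic of \<open>(S, g)\<close> with respect to the Levi-Civita connection of \<open>S\<close> itself: a smooth
  curve in \<open>S\<close> on a nonempty open interval \<open>I\<close> that satisfies the geodesic equation of the
  metric induced on \<open>S\<close> in a chart of \<open>S\<close> around each of its points (equivalently, in all such
  charts). The values of \<open>\<gamma>\<close> outside \<open>I\<close> are irrelevant.\<close>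

definition geodesic ::
  "'a::euclidean_space set \<Rightarrow> ('a \<Rightarrow> 'a \<Rightarrow> 'a \<Rightarrow> real) \<Rightarrow> real set \<Rightarrow> (real \<Rightarrow> 'a) \<Rightarrow> bool" where
  "geodesic S g I \<gamma> \<longleftrightarrow>
     open I \<and> is_interval I \<and> I \<noteq> {} \<and> smooth_on I \<gamma> \<and> \<gamma> ` I \<subseteq> S \<and>
     (\<forall>t\<in>I. \<exists>H W V \<phi> \<psi>. slice_chart S H W V \<phi> \<psi> \<and> \<gamma> t \<in> W \<and>
        geodesic_equation_at H (pullback_metric g \<psi>) (\<phi> \<circ> \<gamma>) t)"

definition maximal_geodesic ::
  "'a::euclidean_space set \<Rightarrow> ('a \<Rightarrow> 'a \<Rightarrow> 'a \<Rightarrow> real) \<Rightarrow> real set \<Rightarrow> (real \<Rightarrow> 'a) \<Rightarrow> bool" where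
  "maximal_geodesic S g I \<gamma> \<longleftrightarrow>
     geodesic S g I \<gamma> \<and>
     (\<forall>J \<eta>. geodesic S g J \<eta> \<and> I \<subseteq> J \<and> (\<forall>t\<in>I. \<eta> t = \<gamma> t) \<longrightarrow> J = I)"

definition geodesically_complete ::
  "'a::euclidean_space set \<Rightarrow> ('a \<Rightarrow> 'a \<Rightarrow> 'a \<Rightarrow> real) \<Rightarrow> bool" where
  "geodesically_complete S g \<longleftrightarrow> (\<forall>I \<gamma>. maximal_geodesic S g I \<gamma> \<longrightarrow> I = UNIV)"

section \<open>Matrix groups\<close>

definition GL :: "(real^'n^'n) set" where
  "GL = {A. invertible A}"

definition SL :: "(real^'n^'n) set" where
  "SL = {A. det A = 1}"

definition trace_metric :: "real^'n^'n \<Rightarrow> real^'n^'n \<Rightarrow> real^'n^'n \<Rightarrow> real" where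
  "trace_metric A V W = trace (matrix_inv A ** V ** matrix_inv A ** W)"

definition matrix_exp :: "real^'n^'n \<Rightarrow> real^'n^'n" where
  "matrix_exp C = (\<Sum>k. (1 / fact k) *\<^sub>R (((**) C ^^ k) (mat 1)))"

end

theory Submission
  imports Defs
begin

text \<open>With the connection \<open>\<nabla>\<^sub>V W = DW(V) - (V A\<^sup>-\<^sup>1 W + W A\<^sup>-\<^sup>1 V) / 2\<close> of \<open>GL\<close>, differentiating
  \<open>tr (A\<^sup>-\<^sup>1 W) = 0\<close> along a curve in \<open>SL\<close> shows that covariant derivatives of tangent fields are
  again tangent. So \<open>SL\<close> is totally geodesic, and in any slice chart the geodesic equation of \<open>SL\<close>
  becomes \<open>P'' = P' P\<^sup>-\<^sup>1 P'\<close>. It says that \<open>C = P\<^sup>-\<^sup>1 P'\<close> is constant, and then \<open>P' = P C\<close> is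
  solved by \<open>K exp (t C)\<close>.\<close>

section \<open>Calculus of smooth maps\<close>

text \<open>The Christoffel form in the definition of a geodesic is picked by \<open>SOME\<close>,
  in a chart of \<open>SL\<close> and for the induced metric. It becomes computable through
  uniqueness of the Levi-Civita form, so an explicit candidate is verified: the second derivative of
  the chart inverse plus the connection of \<open>GL\<close>, pulled back to the chart. Its symmetry
  is the equality of mixed second derivatives, its values lie in the chart subspace because
  covariant derivatives of tangent fields are tangent, and compatibility is inherited from
  \<open>GL\<close>. The connection of \<open>GL\<close> comes from differentiating tr(A^-1 V A^-1
  W): each factor A^-1 produces a term with -A^-1 A' A^-1, and half of each term is assigned to V
  and half to W. By cyclicity both halves of the connection term have the same trace after
  multiplication by A^-1; together they are what differentiating A^-1 in tr(A^-1 W) produces. A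
  geodesic on any interval turns out to be the restriction of an exponential curve on the whole
  line, which settles classification, maximality and completeness together.\<close>

lemma Ck_on_has_derivative:
  assumes "Ck_on (Suc k) U f" "x \<in> U"
  shows "(f has_derivative frechet_derivative f (at x)) (at x)"
  using assms frechet_derivative_works by auto

lemma Ck_on_cong:
  assumes "open U"
  shows "(\<And>x. x \<in> U \<Longrightarrow> f x = g x) \<Longrightarrow> Ck_on k U f \<Longrightarrow> Ck_on k U g"
proof (induction k arbitrary: f g)
  case 0
  then show ?case by (metis Ck_on.simps(1) continuous_on_cong)
next
  case (Suc k)
  have g: "(g has_derivative frechet_derivative f (at x)) (at x)" if "x \<in> U" for x
    using has_derivative_transform_within_open[OF Ck_on_has_derivative[OF Suc.prems(2) that]
        \<open>open U\<close> that] Suc.prems(1) by metis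
  have "Ck_on k U (\<lambda>x. frechet_derivative g (at x) v)" for v
  proof (rule Suc.IH)
    show "frechet_derivative f (at x) v = frechet_derivative g (at x) v" if "x \<in> U" for x
      using frechet_derivative_at[OF g[OF that]] by simp
    show "Ck_on k U (\<lambda>x. frechet_derivative f (at x) v)"
      using Suc.prems(2) by simp
  qed
  then show ?case
    using g by (auto simp: differentiable_def)
qed

text \<open>\<open>Ck_on\<close> is phrased with \<open>frechet_derivative\<close>; uniqueness of
  the derivative lets an explicit formula stand in for it. The inductive closure properties below
  rest on this rule.\<close>

lemma Ck_on_SucI:
  assumes "open U" "\<And>x. x \<in> U \<Longrightarrow> (f has_derivative f' x) (at x)" "\<And>v. Ck_on k U (\<lambda>x. f' x v)"
  shows "Ck_on (Suc k) U f"
proof -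
  have "Ck_on k U (\<lambda>x. frechet_derivative f (at x) v)" for v
  proof (rule Ck_on_cong[OF assms(1)])
    show "f' x v = frechet_derivative f (at x) v" if "x \<in> U" for x
      using frechet_derivative_at[OF assms(2)[OF that]] by metis
  qed (rule assms(3))
  then show ?thesis
    using assms(2) by (auto simp: differentiable_def)
qed

lemma Ck_on_subset: "Ck_on k U f \<Longrightarrow> V \<subseteq> U \<Longrightarrow> Ck_on k V f"
  by (induction k arbitrary: f) (auto intro: continuous_on_subset)

lemma Ck_on_Suc_imp: "Ck_on (Suc k) U f \<Longrightarrow> Ck_on k U f"
proof (induction k arbitrary: f)
  case 0
  then show ?case
    by (simp add: continuous_at_imp_continuous_on differentiable_imp_continuous_within)
qed auto

lemma Ck_on_local:
  assumes "\<And>p. p \<in> U \<Longrightarrow> \<exists>N. open N \<and> p \<in> N \<and> Ck_on k N f"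
  shows "Ck_on k U f"
  using assms
proof (induction k arbitrary: f)
  case 0
  have "isCont f p" if "p \<in> U" for p
    using 0[OF that] by (auto simp: continuous_on_eq_continuous_at)
  then show ?case by (simp add: continuous_at_imp_continuous_on)
next
  case (Suc k)
  show ?case
    using Suc.prems by (auto intro!: Suc.IH) (metis Ck_on.simps(2))+
qed

text \<open>A local extension agrees with \<open>f\<close> on a smaller open set, and
  \<open>Ck_on\<close> is a local property, so the extensions disappear and smoothness can be proved
  by induction on the order.\<close>

lemma smooth_on_open_iff:
  assumes "open U"
  shows "smooth_on U f \<longleftrightarrow> (\<forall>k. Ck_on k U f)"
proof
  assume f: "smooth_on U f"
  show "\<forall>k. Ck_on k U f"
  proof (intro allI Ck_on_local)
    fix k p assume "p \<in> U"
    then obtain N F where N: "open N" "p \<in> N" "\<And>k. Ck_on k N F" "\<And>x. x \<in> N \<inter> U \<Longrightarrow> F x = f x"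
      using f unfolding smooth_on_def by metis
    then have "Ck_on k (N \<inter> U) f"
      using assms by (intro Ck_on_cong[OF _ _ Ck_on_subset[OF N(3)]]) auto
    then show "\<exists>N. open N \<and> p \<in> N \<and> Ck_on k N f"
      using N assms \<open>p \<in> U\<close> by blast
  qed
qed (use assms in \<open>auto simp: smooth_on_def\<close>)

lemma Ck_on_const [simp]: "Ck_on k U (\<lambda>x. c)"
  by (induction k arbitrary: c) auto

lemma Ck_on_bounded_linear:
  assumes "open U" and L: "bounded_linear L"
  shows "Ck_on k U f \<Longrightarrow> Ck_on k U (\<lambda>x. L (f x))"
proof (induction k arbitrary: f)
  case 0
  then show ?case using bounded_linear.continuous_on[OF L] by auto
next
  case (Suc k)
  show ?case
    using Suc.prems
    by (intro Ck_on_SucI[OF \<open>open U\<close>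
          bounded_linear.has_derivative[OF L Ck_on_has_derivative[OF Suc.prems]]] Suc.IH) auto
qed

lemma Ck_on_id: "open U \<Longrightarrow> Ck_on k U (\<lambda>x. x)"
  by (cases k) (auto intro!: Ck_on_SucI[OF _ has_derivative_ident])

lemma Ck_on_linear: "open U \<Longrightarrow> bounded_linear L \<Longrightarrow> Ck_on k U L"
  using Ck_on_bounded_linear[OF _ _ Ck_on_id] by blast

lemma Ck_on_add:
  assumes "open U"
  shows "Ck_on k U f \<Longrightarrow> Ck_on k U g \<Longrightarrow> Ck_on k U (\<lambda>x. f x + g x)"
proof (induction k arbitrary: f g)
  case 0
  then show ?case by (simp add: continuous_on_add)
next
  case (Suc k)
  show ?case
    using Suc.prems
    by (intro Ck_on_SucI[OF assms has_derivative_add[OF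
          Ck_on_has_derivative[OF Suc.prems(1)] Ck_on_has_derivative[OF Suc.prems(2)]]] Suc.IH) auto
qed

lemma Ck_on_bilinear:
  assumes "open U" and B: "bounded_bilinear B"
  shows "Ck_on k U f \<Longrightarrow> Ck_on k U g \<Longrightarrow> Ck_on k U (\<lambda>x. B (f x) (g x))"
proof (induction k arbitrary: f g)
  case 0
  then show ?case using bounded_bilinear.continuous_on[OF B] by auto
next
  case (Suc k)
  \<comment> \<open>Each term of the Leibniz rule pairs a differentiated factor with an
    undifferentiated one, so the factors themselves are also needed at order
    \<open>k\<close>.\<close>
  note prems = Suc.prems Suc.prems[THEN Ck_on_Suc_imp]
  show ?case
    by (intro Ck_on_SucI[OF \<open>open U\<close> bounded_bilinear.FDERIV[OF B
          Ck_on_has_derivative[OF prems(1)] Ck_on_has_derivative[OF prems(2)]]]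
        Ck_on_add \<open>open U\<close> Suc.IH prems)
      (use prems(1,2) in simp_all)
qed

lemmas Ck_on_mult = Ck_on_bilinear[OF _ bounded_bilinear_mult]
lemmas Ck_on_scaleR = Ck_on_bilinear[OF _ bounded_bilinear_scaleR]

lemma Ck_on_minus: "open U \<Longrightarrow> Ck_on k U f \<Longrightarrow> Ck_on k U (\<lambda>x. - f x)"
  by (rule Ck_on_bounded_linear[OF _ bounded_linear_minus[OF bounded_linear_ident]])

lemma Ck_on_diff:
  "open U \<Longrightarrow> Ck_on k U f \<Longrightarrow> Ck_on k U g \<Longrightarrow> Ck_on k U (\<lambda>x. f x - g x)"
  using Ck_on_add[OF _ _ Ck_on_minus, of U k f g] by simp

lemma Ck_on_sum:
  assumes "open U" "\<And>i. i \<in> I \<Longrightarrow> Ck_on k U (f i)"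
  shows "Ck_on k U (\<lambda>x. \<Sum>i\<in>I. f i x)"
  using assms(2) by (induction I rule: infinite_finite_induct) (auto intro: Ck_on_add[OF assms(1)])

lemma Ck_on_prod:
  fixes f :: "'i \<Rightarrow> 'a::real_normed_vector \<Rightarrow> real"
  assumes "open U" "\<And>i. i \<in> I \<Longrightarrow> Ck_on k U (f i)"
  shows "Ck_on k U (\<lambda>x. \<Prod>i\<in>I. f i x)"
  using assms(2) by (induction I rule: infinite_finite_induct) (auto intro: Ck_on_mult[OF assms(1)])

text \<open>The derivative of 1/f is -(1/f) f' (1/f), in which 1/f occurs undifferentiated, so the
  induction on the order closes.\<close>

lemma Ck_on_inverse:
  fixes f :: "'a::real_normed_vector \<Rightarrow> real"
  assumes "open U" and nz: "\<And>x. x \<in> U \<Longrightarrow> f x \<noteq> 0"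
  shows "Ck_on k U f \<Longrightarrow> Ck_on k U (\<lambda>x. inverse (f x))"
proof (induction k)
  case 0
  then show ?case using nz by (auto intro!: continuous_intros)
next
  case (Suc k)
  show ?case
    by (intro Ck_on_SucI[OF \<open>open U\<close> Deriv.has_derivative_inverse[OF _
            Ck_on_has_derivative[OF Suc.prems]]]
        Ck_on_minus Ck_on_mult \<open>open U\<close> Suc.IH Ck_on_Suc_imp[OF Suc.prems])
      (use Suc.prems nz in auto)
qed

lemma Ck_on_divide:
  fixes f g :: "'a::real_normed_vector \<Rightarrow> real"
  assumes "open U" "\<And>x. x \<in> U \<Longrightarrow> g x \<noteq> 0" "Ck_on k U f" "Ck_on k U g"
  shows "Ck_on k U (\<lambda>x. f x / g x)"
  unfolding divide_inverse using assms by (intro Ck_on_mult Ck_on_inverse)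

lemma Ck_on_componentwise:
  fixes f :: "'a::real_normed_vector \<Rightarrow> 'b::euclidean_space"
  assumes "open U" "\<And>b. b \<in> Basis \<Longrightarrow> Ck_on k U (\<lambda>x. f x \<bullet> b)"
  shows "Ck_on k U f"
  using Ck_on_sum[OF assms(1) Ck_on_scaleR[OF assms(1) assms(2) Ck_on_const],
      of Basis "\<lambda>b. b" "\<lambda>b. b"]
  by (simp add: euclidean_representation)

section \<open>Second derivatives: symmetry and the product rule along curves\<close>

abbreviation second_derivative ::
  "('a::real_normed_vector \<Rightarrow> 'b::real_normed_vector) \<Rightarrow> 'a \<Rightarrow> 'a \<Rightarrow> 'a \<Rightarrow> 'b" where
  "second_derivative f x u v \<equiv> frechet_derivative (\<lambda>y. frechet_derivative f (at y) v) (at x) u"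

lemma has_vector_derivative_chain:
  assumes "(c has_vector_derivative c') (at t)" "(f has_derivative f') (at (c t))"
  shows "((\<lambda>s. f (c s)) has_vector_derivative f' c') (at t)"
proof -
  have "linear f'"
    using assms(2) has_derivative_linear by blast
  then show ?thesis
    using has_derivative_compose[OF assms(1)[unfolded has_vector_derivative_def] assms(2)]
    by (simp add: has_vector_derivative_def linear_scale)
qed

lemma has_vector_derivative_line:
  "((\<lambda>s. x + s *\<^sub>R u) has_vector_derivative u) (at t)"
  by (auto intro!: derivative_eq_intros)

lemma Ck_on_2_derivatives:
  assumes "Ck_on 2 U f" "x \<in> U"
  shows "(f has_derivative frechet_derivative f (at x)) (at x)"
    and "((\<lambda>y. frechet_derivative f (at y) v) has_derivative
           (\<lambda>u. second_derivative f x u v)) (at x)"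
proof -
  show "(f has_derivative frechet_derivative f (at x)) (at x)"
    using assms by (intro Ck_on_has_derivative[of "Suc 0"]) (simp_all add: numeral_2_eq_2)
  show "((\<lambda>y. frechet_derivative f (at y) v) has_derivative
      (\<lambda>u. second_derivative f x u v)) (at x)"
    using assms by (intro Ck_on_has_derivative[of 0]) (simp_all add: numeral_2_eq_2)
qed

text \<open>The mean value theorem is applied twice, first in direction \<open>u\<close> to the
  difference of \<open>f\<close> over the two opposite sides, then in direction \<open>v\<close> to
  the derivative in direction \<open>u\<close>.\<close>

lemma second_difference:
  fixes f :: "'a::real_normed_vector \<Rightarrow> real"
  assumes f: "Ck_on 2 U f" and "t > 0"
    and box: "\<And>a b. 0 \<le> a \<Longrightarrow> a \<le> t \<Longrightarrow> 0 \<le> b \<Longrightarrow> b \<le> t \<Longrightarrow> x + a *\<^sub>R u + b *\<^sub>R v \<in> U"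
  shows "\<exists>a b. 0 < a \<and> a < t \<and> 0 < b \<and> b < t \<and>
    f (x + t *\<^sub>R u + t *\<^sub>R v) - f (x + t *\<^sub>R u) - f (x + t *\<^sub>R v) + f x =
      t\<^sup>2 * second_derivative f (x + a *\<^sub>R u + b *\<^sub>R v) v u"
proof -
  let ?D = "\<lambda>y. frechet_derivative f (at y) u"
  have "((\<lambda>a. f (x + a *\<^sub>R u + b *\<^sub>R v)) has_vector_derivative ?D (x + a *\<^sub>R u + b *\<^sub>R v)) (at a)"
    if "0 \<le> a" "a \<le> t" "0 \<le> b" "b \<le> t" for a b
    by (rule has_vector_derivative_chain[where c = "\<lambda>a. x + a *\<^sub>R u + b *\<^sub>R v"])
      (auto intro!: derivative_eq_intros Ck_on_2_derivatives(1)[OF f box] that)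
  note der = this[folded has_real_derivative_iff_has_vector_derivative]
  \<comment> \<open>The zero multiples are left unsimplified so that the equation has the endpoint
    form of \<open>MVT2\<close> on the interval from 0 to \<open>t\<close>.\<close>
  have "\<exists>a>0. a < t \<and>
      (f (x + t *\<^sub>R u + t *\<^sub>R v) - f (x + t *\<^sub>R u)) - (f (x + 0 *\<^sub>R u + t *\<^sub>R v) - f (x + 0 *\<^sub>R u)) =
      (t - 0) * (?D (x + a *\<^sub>R u + t *\<^sub>R v) - ?D (x + a *\<^sub>R u))"
    using der[of _ t] der[of _ 0] \<open>t > 0\<close>
    by (intro MVT2[where f = "\<lambda>a. f (x + a *\<^sub>R u + t *\<^sub>R v) - f (x + a *\<^sub>R u)"])
      (auto intro!: DERIV_diff)
  then obtain a where a: "0 < a" "a < t"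
    and fa: "f (x + t *\<^sub>R u + t *\<^sub>R v) - f (x + t *\<^sub>R u) - f (x + t *\<^sub>R v) + f x =
      t * (?D (x + a *\<^sub>R u + t *\<^sub>R v) - ?D (x + a *\<^sub>R u))"
    by auto
  have "((\<lambda>b. ?D (x + a *\<^sub>R u + b *\<^sub>R v)) has_vector_derivative
      second_derivative f (x + a *\<^sub>R u + b *\<^sub>R v) v u) (at b)"
    if "0 \<le> b" "b \<le> t" for b
    by (rule has_vector_derivative_chain[where f = ?D, OF has_vector_derivative_line])
      (use Ck_on_2_derivatives(2)[OF f box] that a in auto)
  note der2 = this[folded has_real_derivative_iff_has_vector_derivative]
  have "\<exists>b>0. b < t \<and> ?D (x + a *\<^sub>R u + t *\<^sub>R v) - ?D (x + a *\<^sub>R u + 0 *\<^sub>R v) =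
      (t - 0) * second_derivative f (x + a *\<^sub>R u + b *\<^sub>R v) v u"
    using der2 \<open>t > 0\<close> by (intro MVT2) auto
  then show ?thesis
    using a fa by (auto simp: power2_eq_square)
qed

text \<open>The second difference over a small parallelogram does not change when \<open>u\<close>
  and \<open>v\<close> are exchanged. It equals t^2 times either mixed derivative at some point of
  the parallelogram, and continuity of both at \<open>x\<close> makes their values there agree up to
  any \<open>e\<close>.\<close>

lemma second_derivative_symmetric_real:
  fixes f :: "'a::real_normed_vector \<Rightarrow> real"
  assumes f: "Ck_on 2 U f" and "open U" "x \<in> U"
  shows "second_derivative f x u v = second_derivative f x v u"
proof -
  have cont: "((\<lambda>y. second_derivative f y u v) \<longlongrightarrow> second_derivative f x u v) (nhds x)" for u v
  proof -
    have "isCont (\<lambda>y. second_derivative f y u v) x"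
      using f assms(2,3) by (simp add: numeral_2_eq_2 continuous_on_eq_continuous_at)
    then show ?thesis
      using tendsto_at_iff_tendsto_nhds[of "\<lambda>y. second_derivative f y u v" x]
      by (simp add: isCont_def)
  qed
  have "\<bar>second_derivative f x u v - second_derivative f x v u\<bar> < e" if "e > 0" for e
  proof -
    have near_x: "\<forall>\<^sub>F y in nhds x. dist (second_derivative f y u v) (second_derivative f x u v) < e / 2"
      for u v
      using \<open>e > 0\<close> by (intro tendstoD[OF cont]) simp
    have "\<forall>\<^sub>F y in nhds x. y \<in> U \<and>
        dist (second_derivative f y u v) (second_derivative f x u v) < e / 2 \<and>
        dist (second_derivative f y v u) (second_derivative f x v u) < e / 2"
      by (intro eventually_conj eventually_nhds_in_open assms near_x)
    then obtain d where "d > 0" and d: "\<And>y. dist y x < d \<Longrightarrow> y \<in> U \<and>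
        dist (second_derivative f y u v) (second_derivative f x u v) < e / 2 \<and>
        dist (second_derivative f y v u) (second_derivative f x v u) < e / 2"
      by (auto simp: eventually_nhds_metric)
    \<comment> \<open>Makes the parallelogram with sides \<open>t *\<^sub>R u\<close> and
      \<open>t *\<^sub>R v\<close> fit into the ball of radius \<open>d\<close>; the summand 1 keeps
      the denominator positive when both vectors vanish.\<close>
    define t where "t = d / (2 * (norm u + norm v + 1))"
    have pos: "norm u + norm v + 1 > 0"
      by (smt (verit) norm_ge_zero)
    then have "t > 0" and td: "t * (norm u + norm v + 1) = d / 2"
      using \<open>d > 0\<close> by (auto simp: t_def field_simps)
    have near: "dist (x + a *\<^sub>R u + b *\<^sub>R v) x < d" if "0 \<le> a" "a \<le> t" "0 \<le> b" "b \<le> t" for a b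
    proof -
      have "dist (x + a *\<^sub>R u + b *\<^sub>R v) x \<le> a * norm u + b * norm v"
        using norm_triangle_ineq[of "a *\<^sub>R u" "b *\<^sub>R v"] that by (simp add: dist_norm)
      also have "\<dots> \<le> t * norm u + t * norm v"
        using that by (intro add_mono mult_right_mono) auto
      also have "\<dots> < d"
        using td \<open>t > 0\<close> \<open>d > 0\<close> by (simp add: algebra_simps)
      finally show ?thesis .
    qed
    have near': "dist (x + a *\<^sub>R v + b *\<^sub>R u) x < d" if "0 \<le> a" "a \<le> t" "0 \<le> b" "b \<le> t" for a b
      using near[of b a] that by (simp add: ac_simps)
    obtain a b where ab: "0 < a" "a < t" "0 < b" "b < t"
      "f (x + t *\<^sub>R u + t *\<^sub>R v) - f (x + t *\<^sub>R u) - f (x + t *\<^sub>R v) + f x =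
        t\<^sup>2 * second_derivative f (x + a *\<^sub>R u + b *\<^sub>R v) v u"
      using second_difference[OF f \<open>t > 0\<close>, of x u v] d near by metis
    obtain a' b' where ab': "0 < a'" "a' < t" "0 < b'" "b' < t"
      "f (x + t *\<^sub>R v + t *\<^sub>R u) - f (x + t *\<^sub>R v) - f (x + t *\<^sub>R u) + f x =
        t\<^sup>2 * second_derivative f (x + a' *\<^sub>R v + b' *\<^sub>R u) u v"
      using second_difference[OF f \<open>t > 0\<close>, of x v u] d near' by metis
    have "f (x + t *\<^sub>R v + t *\<^sub>R u) = f (x + t *\<^sub>R u + t *\<^sub>R v)"
      by (simp add: ac_simps)
    then have "t\<^sup>2 * second_derivative f (x + a *\<^sub>R u + b *\<^sub>R v) v u =
        t\<^sup>2 * second_derivative f (x + a' *\<^sub>R v + b' *\<^sub>R u) u v"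
      using ab(5) ab'(5) by linarith
    then have "second_derivative f (x + a *\<^sub>R u + b *\<^sub>R v) v u =
        second_derivative f (x + a' *\<^sub>R v + b' *\<^sub>R u) u v"
      using \<open>t > 0\<close> by simp
    moreover have "\<bar>second_derivative f (x + a *\<^sub>R u + b *\<^sub>R v) v u - second_derivative f x v u\<bar> < e / 2"
      using d[OF near, of a b] ab(1-4) by (simp add: dist_real_def)
    moreover have "\<bar>second_derivative f (x + a' *\<^sub>R v + b' *\<^sub>R u) u v - second_derivative f x u v\<bar> < e / 2"
      using d[OF near', of a' b'] ab'(1-4) by (simp add: dist_real_def)
    ultimately show ?thesis
      by linarith
  qed
  then show ?thesis
    by (metis abs_eq_0 eq_iff_diff_eq_0 less_irrefl zero_less_abs_iff)
qed

text \<open>The mean value argument is tied to real values, so it is applied to each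
  component.\<close>

lemma second_derivative_symmetric:
  fixes f :: "'a::real_normed_vector \<Rightarrow> 'b::euclidean_space"
  assumes f: "Ck_on 2 U f" and "open U" "x \<in> U"
  shows "second_derivative f x u v = second_derivative f x v u"
proof (rule euclidean_eqI)
  fix b :: 'b assume "b \<in> Basis"
  have fb: "Ck_on 2 U (\<lambda>y. f y \<bullet> b)"
    by (rule Ck_on_bounded_linear[OF assms(2) bounded_linear_inner_left f])
  have D: "frechet_derivative (\<lambda>y. f y \<bullet> b) (at y) v = frechet_derivative f (at y) v \<bullet> b"
    if "y \<in> U" for y v
    using frechet_derivative_at[OF bounded_linear.has_derivative[OF bounded_linear_inner_left
          Ck_on_2_derivatives(1)[OF f that]], of b] by metis
  have "second_derivative (\<lambda>y. f y \<bullet> b) x u v = second_derivative f x u v \<bullet> b" for u v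
  proof -
    have "((\<lambda>y. frechet_derivative f (at y) v \<bullet> b) has_derivative
        (\<lambda>u. second_derivative f x u v \<bullet> b)) (at x)"
      by (rule bounded_linear.has_derivative[OF bounded_linear_inner_left
            Ck_on_2_derivatives(2)[OF f assms(3)]])
    then have "((\<lambda>y. frechet_derivative (\<lambda>y. f y \<bullet> b) (at y) v) has_derivative
        (\<lambda>u. second_derivative f x u v \<bullet> b)) (at x)"
      by (rule has_derivative_transform_within_open[OF _ assms(2,3)]) (simp add: D)
    then show ?thesis
      using frechet_derivative_at by metis
  qed
  then show "second_derivative f x u v \<bullet> b = second_derivative f x v u \<bullet> b"
    using second_derivative_symmetric_real[OF fb assms(2,3), of u v] by simp
qed

text \<open>\<open>Ck_on\<close> gives differentiability of the derivative of \<open>f\<close> in a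
  fixed direction. The moving vector \<open>w\<close> is therefore expanded in \<open>Basis\<close>,
  with the product rule applied to each coefficient.\<close>

lemma has_vector_derivative_frechet_derivative:
  fixes f :: "'a::euclidean_space \<Rightarrow> 'b::euclidean_space"
  assumes f: "Ck_on 2 U f" and U: "open U"
    and J: "open J" "t \<in> J" "c ` J \<subseteq> U"
    and c: "(c has_vector_derivative c') (at t)" and w: "(w has_vector_derivative w') (at t)"
  shows "((\<lambda>s. frechet_derivative f (at (c s)) (w s)) has_vector_derivative
    second_derivative f (c t) c' (w t) + frechet_derivative f (at (c t)) w') (at t)"
proof -
  let ?D = "\<lambda>y. frechet_derivative f (at y)"
  have ct: "c t \<in> U"
    using J by auto
  have lin: "linear (?D y)" if "y \<in> U" for y
    using Ck_on_2_derivatives(1)[OF f that] has_derivative_linear by blast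
  have expand: "(\<Sum>b\<in>Basis. (v \<bullet> b) *\<^sub>R ?D y b) = ?D y v" if "y \<in> U" for y v
    using linear_sum[OF lin[OF that], of "\<lambda>b. (v \<bullet> b) *\<^sub>R b" Basis]
    by (simp add: linear_scale[OF lin[OF that]] euclidean_representation)
  have inner_der: "((\<lambda>s. w s \<bullet> b) has_vector_derivative w' \<bullet> b) (at t)" for b
    by (rule has_vector_derivative_chain[OF w bounded_linear_imp_has_derivative[OF
          bounded_linear_inner_left]])
  have D_der: "((\<lambda>s. ?D (c s) b) has_vector_derivative second_derivative f (c t) c' b) (at t)" for b
    by (rule has_vector_derivative_chain[OF c Ck_on_2_derivatives(2)[OF f ct]])
  have "((\<lambda>s. \<Sum>b\<in>Basis. (w s \<bullet> b) *\<^sub>R ?D (c s) b) has_vector_derivative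
      (\<Sum>b\<in>Basis. (w t \<bullet> b) *\<^sub>R second_derivative f (c t) c' b + (w' \<bullet> b) *\<^sub>R ?D (c t) b)) (at t)"
    using inner_der D_der
    by (intro has_vector_derivative_sum has_vector_derivative_scaleR)
      (auto simp: has_real_derivative_iff_has_vector_derivative)
  \<comment> \<open>Linearity of the second derivative in its inner direction: with the coefficients
    frozen at time \<open>t\<close>, both sides are derivatives of the same function.\<close>
  moreover have "(\<Sum>b\<in>Basis. (w t \<bullet> b) *\<^sub>R second_derivative f (c t) c' b) =
      second_derivative f (c t) c' (w t)"
  proof -
    have "((\<lambda>y. \<Sum>b\<in>Basis. (w t \<bullet> b) *\<^sub>R ?D y b) has_derivative
        (\<lambda>u. \<Sum>b\<in>Basis. (w t \<bullet> b) *\<^sub>R second_derivative f (c t) u b)) (at (c t))"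
      by (intro has_derivative_sum has_derivative_scaleR_right Ck_on_2_derivatives(2)[OF f ct])
    then have "((\<lambda>y. ?D y (w t)) has_derivative
        (\<lambda>u. \<Sum>b\<in>Basis. (w t \<bullet> b) *\<^sub>R second_derivative f (c t) u b)) (at (c t))"
      by (rule has_derivative_transform_within_open[OF _ U ct]) (simp add: expand)
    from fun_cong[OF frechet_derivative_at[OF this], of c'] show ?thesis .
  qed
  ultimately have "((\<lambda>s. \<Sum>b\<in>Basis. (w s \<bullet> b) *\<^sub>R ?D (c s) b) has_vector_derivative
      second_derivative f (c t) c' (w t) + ?D (c t) w') (at t)"
    by (simp add: sum.distrib expand[OF ct])
  then show ?thesis
    using J by (elim has_vector_derivative_transform_within_open[OF _ J(1,2)]) (auto intro: expand)
qed

lemma Ck_on_vector_derivative: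
  fixes \<gamma> :: "real \<Rightarrow> 'a::real_normed_vector"
  assumes "open I" "Ck_on (Suc k) I \<gamma>"
  shows "t \<in> I \<Longrightarrow> (\<gamma> has_vector_derivative vector_derivative \<gamma> (at t)) (at t)"
    and "Ck_on k I (\<lambda>t. vector_derivative \<gamma> (at t))"
proof -
  show "(\<gamma> has_vector_derivative vector_derivative \<gamma> (at t)) (at t)" if "t \<in> I" for t
    using assms(2) that by (auto simp: vector_derivative_works)
  show "Ck_on k I (\<lambda>t. vector_derivative \<gamma> (at t))"
  proof (rule Ck_on_cong[OF assms(1)])
    show "frechet_derivative \<gamma> (at t) 1 = vector_derivative \<gamma> (at t)" if "t \<in> I" for t
      using assms(2) that by (simp add: frechet_derivative_eq_vector_derivative)
  qed (use assms(2) in simp)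
qed

section \<open>Real matrices\<close>

lemma bounded_bilinear_matrix_mult:
  "bounded_bilinear ((**) :: real^'k^'m \<Rightarrow> real^'n^'k \<Rightarrow> real^'n^'m)"
proof (intro bilinear_conv_bounded_bilinear[THEN iffD1] bilinear_def[THEN iffD2] conjI allI)
  show "linear ((**) A :: real^'n^'k \<Rightarrow> real^'n^'m)" for A
    by (rule linearI) (simp_all add: matrix_add_ldistrib matrix_scalar_ac scalar_matrix_assoc)
  show "linear (\<lambda>A. A ** B :: real^'n^'m)" for B :: "real^'n^'k"
    by (rule linearI)
      (simp_all add: matrix_matrix_mult_def vec_eq_iff algebra_simps sum.distrib sum_distrib_left)
qed

lemmas matrix_mult_linear_simps =
  bounded_bilinear.add_left[OF bounded_bilinear_matrix_mult]
  bounded_bilinear.add_right[OF bounded_bilinear_matrix_mult]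
  bounded_bilinear.diff_left[OF bounded_bilinear_matrix_mult]
  bounded_bilinear.diff_right[OF bounded_bilinear_matrix_mult]
  bounded_bilinear.minus_left[OF bounded_bilinear_matrix_mult]
  bounded_bilinear.minus_right[OF bounded_bilinear_matrix_mult]
  bounded_bilinear.scaleR_left[OF bounded_bilinear_matrix_mult]
  bounded_bilinear.scaleR_right[OF bounded_bilinear_matrix_mult]

lemmas has_vector_derivative_matrix_mult =
  bounded_bilinear.has_vector_derivative[OF bounded_bilinear_matrix_mult]

lemmas Ck_on_matrix_mult = Ck_on_bilinear[OF _ bounded_bilinear_matrix_mult]

lemma linear_trace: "linear (trace :: real^'n^'n \<Rightarrow> real)"
  by (rule linearI) (simp_all add: trace_def sum.distrib sum_distrib_left)

lemmas bounded_linear_trace = linear_trace[unfolded linear_conv_bounded_linear]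

lemmas trace_linear_simps = linear_add[OF linear_trace] linear_diff[OF linear_trace]
  linear_scale[OF linear_trace] linear_neg[OF linear_trace] linear_0[OF linear_trace]

lemma bounded_linear_entry: "bounded_linear (\<lambda>A :: real^'n^'m. A $ i $ j)"
  using bounded_linear_compose[OF bounded_linear_vec_nth bounded_linear_vec_nth] .

lemma inner_Basis_matrix:
  assumes "b \<in> (Basis :: (real^'n^'m) set)"
  obtains i j where "\<And>A. A \<bullet> b = A $ i $ j"
  using assms by (auto simp: Basis_vec_def inner_axis)

lemma Ck_on_matrixI:
  fixes f :: "'a::real_normed_vector \<Rightarrow> real^'n^'m"
  assumes "open U" "\<And>i j. Ck_on k U (\<lambda>x. f x $ i $ j)"
  shows "Ck_on k U f"
proof (rule Ck_on_componentwise[OF assms(1)])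
  fix b :: "real^'n^'m" assume "b \<in> Basis"
  then show "Ck_on k U (\<lambda>x. f x \<bullet> b)"
    by (rule inner_Basis_matrix) (simp add: assms(2))
qed

lemma Ck_on_entry: "open U \<Longrightarrow> Ck_on k U f \<Longrightarrow> Ck_on k U (\<lambda>x. (f x :: real^'n^'m) $ i $ j)"
  by (rule Ck_on_bounded_linear[OF _ bounded_linear_entry])

lemma has_vector_derivative_matrixI:
  fixes f :: "real \<Rightarrow> real^'n^'m"
  assumes "\<And>i j. ((\<lambda>s. f s $ i $ j) has_real_derivative f' $ i $ j) (at t)"
  shows "(f has_vector_derivative f') (at t)"
  unfolding has_vector_derivative_def
proof (subst has_derivative_componentwise_within, intro ballI)
  fix b :: "real^'n^'m" assume "b \<in> Basis"
  then obtain i j where b: "\<And>A. A \<bullet> b = A $ i $ j"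
    by (rule inner_Basis_matrix) blast
  show "((\<lambda>x. f x \<bullet> b) has_derivative (\<lambda>x. x *\<^sub>R f' \<bullet> b)) (at t)"
    using assms[of i j] by (simp add: b has_field_derivative_def mult_commute_abs)
qed

section \<open>Determinant and inverse: smoothness and derivatives\<close>

lemma Ck_on_det:
  fixes f :: "'a::real_normed_vector \<Rightarrow> real^'n^'n"
  assumes "open U" "Ck_on k U f"
  shows "Ck_on k U (\<lambda>x. det (f x))"
  unfolding det_def
  by (intro Ck_on_sum Ck_on_mult Ck_on_prod Ck_on_entry Ck_on_const assms)

text \<open>The last two equations cancel inverse pairs inside products that
  \<open>matrix_mul_assoc\<close> has nested to the left.\<close>

lemma matrix_inv_mult [simp]:
  fixes A :: "real^'n^'n"
  assumes "invertible A"
  shows "A ** matrix_inv A = mat 1" "matrix_inv A ** A = mat 1"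
    "B ** A ** matrix_inv A = B" "C ** matrix_inv A ** A = C"
proof -
  show AA: "A ** matrix_inv A = mat 1" "matrix_inv A ** A = mat 1"
    using someI_ex[OF assms[unfolded invertible_def]] by (auto simp: matrix_inv_def)
  show "B ** A ** matrix_inv A = B" "C ** matrix_inv A ** A = C"
    using AA by (simp_all flip: matrix_mul_assoc)
qed

lemma matrix_inv_eqI:
  fixes A B :: "real^'n^'n"
  assumes "B ** A = mat 1"
  shows "matrix_inv A = B"
proof -
  have "invertible A"
    using assms invertible_left_inverse by blast
  then show ?thesis
    using assms by (metis matrix_inv_mult(3) matrix_mul_lid)
qed

lemma invertible_SL: "A \<in> SL \<Longrightarrow> invertible A"
  by (simp add: SL_def invertible_det_nz)

lemma continuous_det: "continuous_on UNIV (det :: real^'n^'n \<Rightarrow> real)"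
  using Ck_on_det[OF open_UNIV Ck_on_id[OF open_UNIV], of 0] by simp

lemma open_GL: "open (GL :: (real^'n^'n) set)"
  using open_vimage[OF open_Compl[OF closed_singleton] continuous_det, of 0]
  by (simp add: Compl_eq  GL_def vimage_def invertible_det_nz)

text \<open>Writes the entries of the inverse as quotients of determinants, which reduces smoothness
  of inversion to that of polynomials.\<close>

lemma matrix_inv_cramer:
  fixes A :: "real^'n^'n"
  assumes "invertible A"
  shows "matrix_inv A $ k $ l =
    det (\<chi> i j. if j = k then axis l 1 $ i else A $ i $ j) / det A"
proof -
  have "A *v (matrix_inv A *v axis l 1) = axis l 1"
    using assms by (simp add: matrix_vector_mul_assoc)
  then have "matrix_inv A *v axis l 1 =
      (\<chi> k. det (\<chi> i j. if j = k then axis l 1 $ i else A $ i $ j) / det A)"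
    using cramer[of A] assms by (simp add: invertible_det_nz)
  moreover have "(matrix_inv A *v axis l 1) $ k = matrix_inv A $ k $ l"
    by (simp add: matrix_vector_mult_def axis_def if_distrib cong: if_cong)
  ultimately show ?thesis
    by simp
qed

lemma Ck_on_matrix_inv:
  fixes f :: "'a::real_normed_vector \<Rightarrow> real^'n^'n"
  assumes "open U" "Ck_on k U f" "\<And>x. x \<in> U \<Longrightarrow> invertible (f x)"
  shows "Ck_on k U (\<lambda>x. matrix_inv (f x))"
proof (rule Ck_on_matrixI[OF assms(1)])
  fix m l
  have "Ck_on k U (\<lambda>x. \<chi> i j. if j = m then axis l 1 $ i else f x $ i $ j)"
  proof (rule Ck_on_matrixI[OF assms(1)])
    fix i j
    show "Ck_on k U (\<lambda>x. (\<chi> i j. if j = m then axis l 1 $ i else f x $ i $ j) $ i $ j)"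
      using Ck_on_entry[OF assms(1,2), of i j] by (cases "j = m") simp_all
  qed
  then have "Ck_on k U (\<lambda>x. det (\<chi> i j. if j = m then axis l 1 $ i else f x $ i $ j) / det (f x))"
    using assms by (intro Ck_on_divide Ck_on_det) (auto simp: invertible_det_nz)
  then show "Ck_on k U (\<lambda>x. matrix_inv (f x) $ m $ l)"
    by (rule Ck_on_cong[OF assms(1), rotated]) (simp add: matrix_inv_cramer assms(3))
qed

text \<open>Differentiability is already known from Cramer's rule; the formula then follows by
  differentiating X X^-1 = 1 and multiplying by A^-1 from the left.\<close>

lemma has_derivative_matrix_inv:
  fixes A :: "real^'n^'n"
  assumes "invertible A"
  shows "(matrix_inv has_derivative (\<lambda>V. - (matrix_inv A ** V ** matrix_inv A))) (at A)"
proof -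
  have A: "A \<in> GL"
    using assms by (simp add: GL_def)
  define D where "D = frechet_derivative (matrix_inv :: real^'n^'n \<Rightarrow> _) (at A)"
  have D: "(matrix_inv has_derivative D) (at A)"
    unfolding D_def
    by (rule Ck_on_has_derivative[where k = 0, OF Ck_on_matrix_inv[OF open_GL Ck_on_id[OF open_GL]] A])
      (simp add: GL_def)
  have "((\<lambda>X. X ** matrix_inv X) has_derivative (\<lambda>V. A ** D V + V ** matrix_inv A)) (at A)"
    by (rule bounded_bilinear.FDERIV[OF bounded_bilinear_matrix_mult has_derivative_ident D])
  then have "((\<lambda>X. mat 1 :: real^'n^'n) has_derivative (\<lambda>V. A ** D V + V ** matrix_inv A)) (at A)"
    by (rule has_derivative_transform_within_open[OF _ open_GL A]) (simp add: GL_def)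
  from fun_cong[OF has_derivative_unique[OF this has_derivative_const]]
  have zero: "A ** D V + V ** matrix_inv A = 0" for V .
  have "D V = - (matrix_inv A ** V ** matrix_inv A)" for V
  proof -
    have "matrix_inv A ** (A ** D V + V ** matrix_inv A) = 0"
      by (simp add: zero)
    then show ?thesis
      using assms by (simp add: matrix_mult_linear_simps matrix_mul_assoc eq_neg_iff_add_eq_0)
  qed
  then have "D = (\<lambda>V. - (matrix_inv A ** V ** matrix_inv A))"
    by blast
  then show ?thesis
    using D by simp
qed

lemma has_vector_derivative_matrix_inv:
  fixes c :: "real \<Rightarrow> real^'n^'n"
  assumes "(c has_vector_derivative c') (at t)" "invertible (c t)"
  shows "((\<lambda>s. matrix_inv (c s)) has_vector_derivative
    - (matrix_inv (c t) ** c' ** matrix_inv (c t))) (at t)"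
  by (rule has_vector_derivative_chain[OF assms(1) has_derivative_matrix_inv[OF assms(2)]])

text \<open>In the differentiated Leibniz expansion each product has one factor removed. A
  permutation other than \<open>id\<close> moves at least two indices, so a zero off-diagonal entry
  of the identity survives; the term of \<open>id\<close> is the trace.\<close>

lemma has_derivative_det_mat_1:
  "((det :: real^'n^'n \<Rightarrow> real) has_derivative trace) (at (mat 1))"
proof -
  let ?U = "UNIV :: 'n set"
  have entry: "((\<lambda>X :: real^'n^'n. X $ i $ j) has_derivative (\<lambda>V. V $ i $ j)) (at (mat 1))" for i j
    by (rule bounded_linear_imp_has_derivative[OF bounded_linear_entry])
  have der: "((det :: real^'n^'n \<Rightarrow> real) has_derivative
      (\<lambda>V. \<Sum>p | p permutes ?U. of_int (sign p) *
        (\<Sum>i\<in>?U. V $ i $ p i * (\<Prod>j\<in>?U - {i}. mat 1 $ j $ p j)))) (at (mat 1))"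
    unfolding det_def
    by (intro has_derivative_sum has_derivative_mult_right has_derivative_prod entry)
  have Z: "(\<Prod>j\<in>?U - {i}. (mat 1 :: real^'n^'n) $ j $ p j) = 0" if "p permutes ?U" "p \<noteq> id" for p i
  proof -
    obtain j where "j \<noteq> i" "p j \<noteq> j"
    proof (rule ccontr)
      assume "\<not> thesis"
      then have fixed: "p j = j" if "j \<noteq> i" for j
        using that \<open>\<And>j. \<lbrakk>j \<noteq> i; p j \<noteq> j\<rbrakk> \<Longrightarrow> thesis\<close> by blast
      then have "p i = i"
        using permutes_inj[OF \<open>p permutes ?U\<close>] by (metis injD)
      then show False
        using fixed \<open>p \<noteq> id\<close> by (metis eq_id_iff)
    qed
    then show ?thesis
      by (intro prod_zero) (auto simp: mat_def intro!: bexI[of _ j])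
  qed
  have "(\<Sum>p | p permutes ?U. of_int (sign p) *
        (\<Sum>i\<in>?U. V $ i $ p i * (\<Prod>j\<in>?U - {i}. mat 1 $ j $ p j))) =
      (\<Sum>p \<in> {id}. of_int (sign p) * (\<Sum>i\<in>?U. V $ i $ p i * (\<Prod>j\<in>?U - {i}. mat 1 $ j $ p j)))"
    for V :: "real^'n^'n"
  proof (rule sum.mono_neutral_right)
    show "\<forall>p\<in>{p. p permutes ?U} - {id}. of_int (sign p) *
        (\<Sum>i\<in>?U. V $ i $ p i * (\<Prod>j\<in>?U - {i}. mat 1 $ j $ p j)) = 0"
    proof
      fix p assume "p \<in> {p. p permutes ?U} - {id}"
      then have p: "p permutes ?U" "p \<noteq> id"
        by auto
      show "of_int (sign p) *
          (\<Sum>i\<in>?U. V $ i $ p i * (\<Prod>j\<in>?U - {i}. mat 1 $ j $ p j)) = 0"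
        by (simp only: Z[OF p] mult_zero_right sum.neutral_const)
    qed
  qed (simp_all add: finite_permutations)
  then have "(\<Sum>p | p permutes ?U. of_int (sign p) *
        (\<Sum>i\<in>?U. V $ i $ p i * (\<Prod>j\<in>?U - {i}. mat 1 $ j $ p j))) = trace V"
    for V :: "real^'n^'n"
    by (simp add: mat_def trace_def)
  then show ?thesis
    using der by simp
qed

text \<open>Jacobi's formula, reduced to the identity matrix by factoring out
  \<open>det (c t)\<close>.\<close>

lemma has_real_derivative_det:
  fixes c :: "real \<Rightarrow> real^'n^'n"
  assumes "(c has_vector_derivative c') (at t)" "invertible (c t)"
  shows "((\<lambda>s. det (c s)) has_real_derivative det (c t) * trace (matrix_inv (c t) ** c')) (at t)"
proof -
  have eq: "det (c s) = det (c t) * det (matrix_inv (c t) ** c s)" for s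
    using assms(2) by (simp add: matrix_mul_assoc flip: det_mul)
  have "((\<lambda>s. matrix_inv (c t) ** c s) has_vector_derivative matrix_inv (c t) ** c') (at t)"
    using has_vector_derivative_matrix_mult[OF has_vector_derivative_const assms(1)] by simp
  then have "((\<lambda>s. det (matrix_inv (c t) ** c s)) has_vector_derivative
      trace (matrix_inv (c t) ** c')) (at t)"
    by (rule has_vector_derivative_chain) (simp add: assms(2) has_derivative_det_mat_1)
  then have "((\<lambda>s. det (c t) * det (matrix_inv (c t) ** c s)) has_real_derivative
      det (c t) * trace (matrix_inv (c t) ** c')) (at t)"
    by (intro DERIV_cmult) (simp add: has_real_derivative_iff_has_vector_derivative)
  then show ?thesis
    by (simp flip: eq)
qed

lemma trace_matrix_mult_transpose: "trace (A ** transpose A) = A \<bullet> (A :: real^'n^'n)"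
  by (simp add: trace_def matrix_matrix_mult_def transpose_def inner_vec_def)

lemma trace_transpose: "trace (transpose A) = trace A"
  by (simp add: trace_def transpose_def)

section \<open>The matrix exponential\<close>

abbreviation matrix_power :: "real^'n^'n \<Rightarrow> nat \<Rightarrow> real^'n^'n" where
  "matrix_power C k \<equiv> ((**) C ^^ k) (mat 1)"

lemma matrix_power_scaleR: "matrix_power (t *\<^sub>R C) k = t ^ k *\<^sub>R matrix_power C k"
  by (induction k) (simp_all add: matrix_mult_linear_simps)

lemma matrix_power_commute: "C ** matrix_power C k = matrix_power C k ** C"
  by (induction k) (simp_all add: matrix_mul_assoc)

text \<open>The norm here is the Euclidean norm of the entries, submultiplicative up to the constant
  \<open>K\<close> of the bounded bilinear product; hence M = \<open>norm C * K\<close>.\<close>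

lemma norm_matrix_power_le:
  "\<exists>M \<ge> 0. \<forall>k. norm (matrix_power C k) \<le> norm (mat 1 :: real^'n^'n) * M ^ k" for C :: "real^'n^'n"
proof -
  obtain K where K: "K > 0" "\<And>(A :: real^'n^'n) (B :: real^'n^'n). norm (A ** B) \<le> norm A * norm B * K"
    using bounded_bilinear.pos_bounded[OF bounded_bilinear_matrix_mult] by blast
  have "norm (matrix_power C k) \<le> norm (mat 1 :: real^'n^'n) * (norm C * K) ^ k" for k
  proof (induction k)
    case (Suc k)
    have "norm (matrix_power C (Suc k)) \<le> norm (matrix_power C k) * (norm C * K)"
      using K(2)[of C "matrix_power C k"] by (simp add: mult_ac)
    also have "\<dots> \<le> norm (mat 1 :: real^'n^'n) * (norm C * K) ^ k * (norm C * K)"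
      using Suc K(1) by (intro mult_right_mono) auto
    finally show ?case
      by (simp add: mult_ac)
  qed simp
  then show ?thesis
    using K(1) by (intro exI[of _ "norm C * K"]) auto
qed

lemma summable_matrix_exp:
  "summable (\<lambda>k. (t ^ k / fact k) *\<^sub>R matrix_power C k)" for C :: "real^'n^'n"
proof -
  obtain M where M: "M \<ge> 0" "\<And>k. norm (matrix_power C k) \<le> norm (mat 1 :: real^'n^'n) * M ^ k"
    using norm_matrix_power_le by blast
  have "norm ((t ^ k / fact k) *\<^sub>R matrix_power C k) \<le>
      norm (mat 1 :: real^'n^'n) * (inverse (fact k) * (\<bar>t\<bar> * M) ^ k)" for k
    using mult_left_mono[OF M(2)[of k], of "\<bar>t\<bar> ^ k / fact k"]
    by (simp add: power_abs field_simps)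
  moreover have "summable (\<lambda>k. norm (mat 1 :: real^'n^'n) * (inverse (fact k) * (\<bar>t\<bar> * M) ^ k))"
    by (rule summable_mult[OF summable_exp])
  ultimately show ?thesis
    by (rule summable_comparison_test'[rotated])
qed

lemma matrix_exp_scaleR:
  "matrix_exp (t *\<^sub>R C) = (\<Sum>k. (t ^ k / fact k) *\<^sub>R matrix_power C k)"
  by (simp add: matrix_exp_def matrix_power_scaleR)

lemma linear_matrix_exp:
  assumes "bounded_linear L"
  shows "L (matrix_exp (t *\<^sub>R C)) = (\<Sum>k. (t ^ k / fact k) *\<^sub>R L (matrix_power C k))"
    and "summable (\<lambda>k. (t ^ k / fact k) *\<^sub>R L (matrix_power C k))"
  using bounded_linear.suminf[OF assms summable_matrix_exp, of t C]
    bounded_linear.summable[OF assms summable_matrix_exp, of t C]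
  by (simp_all add: matrix_exp_scaleR linear_scale[OF bounded_linear.linear[OF assms]])

text \<open>Each entry is an everywhere convergent power series in \<open>t\<close>, which may be
  differentiated termwise.\<close>

lemma has_vector_derivative_matrix_exp:
  "((\<lambda>t. matrix_exp (t *\<^sub>R C)) has_vector_derivative C ** matrix_exp (t *\<^sub>R C)) (at t)"
proof (rule has_vector_derivative_matrixI)
  fix i j
  let ?a = "\<lambda>k. matrix_power C k $ i $ j / fact k"
  have "((\<lambda>t. \<Sum>k. ?a k * t ^ k) has_real_derivative (\<Sum>k. diffs ?a k * t ^ k)) (at t)"
    using linear_matrix_exp(2)[OF bounded_linear_entry]
    by (intro termdiffs_strong_converges_everywhere) (simp add: mult_ac)
  \<comment> \<open>The shift of coefficients: (k + 1) / (k + 1)! = 1 / k!, with one more factor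
    \<open>C\<close> in the power.\<close>
  moreover have "diffs ?a k = (C ** matrix_power C k) $ i $ j / fact k" for k
    by (simp add: diffs_def)
  moreover have "bounded_linear (\<lambda>M. (C ** M) $ i $ j)"
    using bounded_linear_compose[OF bounded_linear_entry
        bounded_bilinear.bounded_linear_right[OF bounded_bilinear_matrix_mult]] .
  from linear_matrix_exp(1)[OF this, of t C]
  have "(C ** matrix_exp (t *\<^sub>R C)) $ i $ j =
      (\<Sum>k. (t ^ k / fact k) * (C ** matrix_power C k) $ i $ j)"
    by simp
  ultimately show "((\<lambda>t. matrix_exp (t *\<^sub>R C) $ i $ j) has_real_derivative
      (C ** matrix_exp (t *\<^sub>R C)) $ i $ j) (at t)"
    by (simp add: linear_matrix_exp(1)[OF bounded_linear_entry] mult_ac)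
qed

lemma matrix_exp_commute: "C ** matrix_exp (t *\<^sub>R C) = matrix_exp (t *\<^sub>R C) ** C"
  using linear_matrix_exp(1)[OF bounded_bilinear.bounded_linear_left[OF
        bounded_bilinear_matrix_mult], of t C C]
    linear_matrix_exp(1)[OF bounded_bilinear.bounded_linear_right[OF
        bounded_bilinear_matrix_mult], of C t C]
  by (simp add: matrix_power_commute)

lemma matrix_exp_0 [simp]: "matrix_exp 0 = (mat 1 :: real^'n^'n)"
proof -
  have "(\<Sum>k. (0 ^ k / fact k) *\<^sub>R matrix_power (0 :: real^'n^'n) k) =
      (\<Sum>k\<in>{0}. (0 ^ k / fact k) *\<^sub>R matrix_power (0 :: real^'n^'n) k)"
    by (rule suminf_finite) auto
  then show ?thesis
    using matrix_exp_scaleR[of 0 "0 :: real^'n^'n"] by simp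
qed

lemma matrix_exp_minus: "matrix_exp (- (t *\<^sub>R C)) ** matrix_exp (t *\<^sub>R C) = mat 1"
proof -
  let ?f = "\<lambda>t. matrix_exp (t *\<^sub>R (- C)) ** matrix_exp (t *\<^sub>R C)"
  have "(?f has_vector_derivative 0) (at t)" for t
    using has_vector_derivative_matrix_mult[OF has_vector_derivative_matrix_exp[of "- C" t]
        has_vector_derivative_matrix_exp[of C t]]
    \<comment> \<open>Moves \<open>- C\<close> to the right of its own exponential, so that both
      summands of the derivative have their factor between the two exponentials and cancel.\<close>
    by (simp only: matrix_exp_commute[of "- C"])
      (simp add: matrix_mult_linear_simps matrix_mul_assoc)
  then obtain K where K: "?f t = K" for t
    using has_vector_derivative_zero_constant[of UNIV ?f] by auto
  show ?thesis
    using K[of t] K[of 0] by simp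
qed

lemma invertible_matrix_exp: "invertible (matrix_exp (t *\<^sub>R C))"
  using matrix_exp_minus invertible_left_inverse by blast

text \<open>By Jacobi's formula and commutation with \<open>C\<close>, the logarithmic derivative of
  the determinant is tr C = 0; the value at 0 is 1.\<close>

lemma det_matrix_exp:
  assumes "trace C = 0"
  shows "det (matrix_exp (t *\<^sub>R C)) = 1"
proof -
  have "((\<lambda>t. det (matrix_exp (t *\<^sub>R C))) has_real_derivative 0) (at t)" for t
    using has_real_derivative_det[OF has_vector_derivative_matrix_exp[of C t] invertible_matrix_exp]
    by (simp add: matrix_exp_commute matrix_mul_assoc invertible_matrix_exp assms)
  then have "det (matrix_exp (t *\<^sub>R C)) = det (matrix_exp (0 *\<^sub>R C))"
    using DERIV_isconst_all[of "\<lambda>t. det (matrix_exp (t *\<^sub>R C))" t 0] by simp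
  then show ?thesis
    by simp
qed

text \<open>Differentiation replaces \<open>K\<close> by \<open>K ** C\<close>, so the induction
  runs over arbitrary \<open>K\<close>.\<close>

lemma Ck_on_matrix_exp:
  "open U \<Longrightarrow> Ck_on k U (\<lambda>t. K ** matrix_exp (t *\<^sub>R C))"
proof (induction k arbitrary: K)
  case 0
  have "isCont (\<lambda>t. K ** matrix_exp (t *\<^sub>R C)) t" for t
    using has_vector_derivative_matrix_mult[OF has_vector_derivative_const
        has_vector_derivative_matrix_exp] has_vector_derivative_continuous by blast
  then show ?case
    by (simp add: continuous_at_imp_continuous_on)
next
  case (Suc k)
  have der: "((\<lambda>t. K ** matrix_exp (t *\<^sub>R C)) has_derivative
      (\<lambda>s. s *\<^sub>R (K ** C ** matrix_exp (t *\<^sub>R C)))) (at t)" for t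
    using has_vector_derivative_matrix_mult[OF has_vector_derivative_const[of K]
        has_vector_derivative_matrix_exp[of C t]]
    by (simp add: has_vector_derivative_def matrix_mul_assoc)
  show ?case
    by (rule Ck_on_SucI[OF \<open>open U\<close> der])
      (intro Ck_on_scaleR Ck_on_const Suc.IH \<open>open U\<close>)
qed

section \<open>Submanifolds and slice charts\<close>

text \<open>The pointwise algebraic clauses of \<open>metric_tensor\<close>, isolated because they
  are needed on tangent spaces and, after pullback, on the subspace \<open>H\<close> of a
  chart.\<close>

definition nondegenerate_form :: "'a::euclidean_space set \<Rightarrow> ('a \<Rightarrow> 'a \<Rightarrow> real) \<Rightarrow> bool" where
  "nondegenerate_form T b \<longleftrightarrow>
     (\<forall>u\<in>T. \<forall>v\<in>T. \<forall>w\<in>T. \<forall>a. b (u + a *\<^sub>R v) w = b u w + a * b v w) \<and>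
     (\<forall>v\<in>T. \<forall>w\<in>T. b v w = b w v) \<and>
     (\<forall>v\<in>T. (\<forall>w\<in>T. b v w = 0) \<longrightarrow> v = 0)"

lemma nondegenerate_formD:
  assumes "nondegenerate_form T b" "u \<in> T" "v \<in> T" "w \<in> T"
  shows "b (u + v) w = b u w + b v w" "b (u - v) w = b u w - b v w" "b v w = b w v"
  using assms(1)[unfolded nondegenerate_form_def, THEN conjunct1, rule_format, of u v w 1]
    assms(1)[unfolded nondegenerate_form_def, THEN conjunct1, rule_format, of u v w "-1"]
    assms(1)[unfolded nondegenerate_form_def, THEN conjunct2, THEN conjunct1] assms
  by auto

lemma nondegenerate_form_eq_0:
  "nondegenerate_form T b \<Longrightarrow> v \<in> T \<Longrightarrow> (\<And>w. w \<in> T \<Longrightarrow> b v w = 0) \<Longrightarrow> v = 0"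
  by (simp add: nondegenerate_form_def)

text \<open>The difference of two Levi-Civita forms gives a trilinear form that is symmetric in the
  first two arguments and antisymmetric in the last two, hence zero.\<close>

lemma levi_civita_form_unique:
  assumes H: "subspace H" and h: "nondegenerate_form H (h x)"
    and lc: "levi_civita_form H h x \<Gamma>" "levi_civita_form H h x \<Gamma>'"
    and "u \<in> H" "v \<in> H"
  shows "\<Gamma> u v = \<Gamma>' u v"
proof -
  define T where "T u v w = h x (\<Gamma> u v - \<Gamma>' u v) w" for u v w
  have closed: "\<Gamma> u v \<in> H" "\<Gamma>' u v \<in> H" "\<Gamma> u v - \<Gamma>' u v \<in> H" if "u \<in> H" "v \<in> H" for u v
    using lc that H by (auto simp: levi_civita_form_def subspace_diff)
  have T: "T u v w = h x (\<Gamma> u v) w - h x (\<Gamma>' u v) w" if "u \<in> H" "v \<in> H" "w \<in> H" for u v w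
    using nondegenerate_formD(2)[OF h] closed that by (simp add: T_def)
  have sym: "T u v w = T v u w" if "u \<in> H" "v \<in> H" for u v w
    using lc that by (simp add: levi_civita_form_def T_def)
  have anti: "T u v w = - T u w v" if uvw: "u \<in> H" "v \<in> H" "w \<in> H" for u v w
  proof -
    have "deriv (\<lambda>s. h (x + s *\<^sub>R u) v w) 0 = h x (\<Gamma> u v) w + h x v (\<Gamma> u w)"
      using lc(1) uvw unfolding levi_civita_form_def by blast
    moreover have "deriv (\<lambda>s. h (x + s *\<^sub>R u) v w) 0 = h x (\<Gamma>' u v) w + h x v (\<Gamma>' u w)"
      using lc(2) uvw unfolding levi_civita_form_def by blast
    moreover have "h x v (\<Gamma> u w) = h x (\<Gamma> u w) v" "h x v (\<Gamma>' u w) = h x (\<Gamma>' u w) v"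
      by (rule nondegenerate_formD(3)[OF h uvw(1,2)]; rule closed[OF uvw(1,3)])+
    ultimately show ?thesis
      using uvw by (simp add: T)
  qed
  have "T u v w = 0" if "w \<in> H" for w
  proof -
    note uvw = \<open>u \<in> H\<close> \<open>v \<in> H\<close> that
    have "T u v w = - T w u v"
      using anti[OF uvw(1,2,3)] sym[OF uvw(1,3)] by simp
    also have "\<dots> = T v w u"
      using anti[OF uvw(3,1,2)] sym[OF uvw(3,2)] by simp
    also have "\<dots> = - T u v w"
      using anti[OF uvw(2,3,1)] sym[OF uvw(2,1)] by simp
    finally show ?thesis
      by simp
  qed
  then have "\<Gamma> u v - \<Gamma>' u v = 0"
    using nondegenerate_form_eq_0[OF h closed(3)] \<open>u \<in> H\<close> \<open>v \<in> H\<close> by (simp add: T_def)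
  then show ?thesis
    by simp
qed

text \<open>Exhibiting one Levi-Civita form makes the choice by \<open>SOME\<close> meaningful;
  uniqueness then identifies its values on \<open>H\<close>.\<close>

lemma christoffel_eq:
  assumes "subspace H" "nondegenerate_form H (h x)" "levi_civita_form H h x \<Gamma>" "u \<in> H" "v \<in> H"
  shows "christoffel H h x u v = \<Gamma> u v"
proof (rule levi_civita_form_unique[OF assms(1,2) _ assms(3-5)])
  show "levi_civita_form H h x (christoffel H h x)"
    unfolding christoffel_def by (rule someI[of "levi_civita_form H h x", OF assms(3)])
qed

text \<open>Nondegeneracy on the tangent space says that a vector both tangent and normal vanishes.
  For tangent \<open>x\<close> any candidate for the normal part is itself tangent.\<close>

lemma normal_part_eq_0:
  assumes T: "subspace (tangent_space S p)" and g: "nondegenerate_form (tangent_space S p) (g p)"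
    and x: "x \<in> tangent_space S p"
  shows "normal_part S g p x = 0"
  unfolding normal_part_def
proof (rule the_equality)
  show "(\<forall>w\<in>tangent_space S p. g p 0 w = 0) \<and> x - 0 \<in> tangent_space S p"
    using nondegenerate_formD(1)[OF g subspace_0[OF T] subspace_0[OF T]] x by simp
next
  fix z assume z: "(\<forall>w\<in>tangent_space S p. g p z w = 0) \<and> x - z \<in> tangent_space S p"
  then have "x - (x - z) \<in> tangent_space S p"
    using subspace_diff[OF T x] by blast
  then show "z = 0"
    using z by (intro nondegenerate_form_eq_0[OF g]) auto
qed

lemma metric_tensor_iff:
  "metric_tensor S g \<longleftrightarrow>
     (\<forall>p\<in>S. nondegenerate_form (tangent_space S p) (g p)) \<and>
     (\<forall>X Y. tangent_field S X \<and> tangent_field S Y \<longrightarrow> smooth_on S (\<lambda>p. g p (X p) (Y p))) \<and>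
     (\<exists>\<nu>. \<forall>p\<in>S. form_index (tangent_space S p) (g p) = \<nu>)"
  unfolding metric_tensor_def nondegenerate_form_def by blast

section \<open>Lines, curves and tangent spaces in slice charts\<close>

lemma open_real_interval_0:
  assumes "open J" "(0::real) \<in> J"
  obtains e where "e > 0" "{-e<..<e} \<subseteq> J"
proof -
  obtain e where "e > 0" "ball 0 e \<subseteq> J"
    using assms open_contains_ball by blast
  then show ?thesis
    using that[of e] ball_eq_greaterThanLessThan[of 0 e] by simp
qed

lemma open_line:
  fixes x :: "'a::real_normed_vector"
  assumes "open U"
  shows "open {s. x + s *\<^sub>R u \<in> U}"
proof -
  have "continuous_on UNIV (\<lambda>s. x + s *\<^sub>R u)"
    by (intro continuous_intros)
  from open_vimage[OF assms this] show ?thesis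
    by (simp add: vimage_def)
qed

text \<open>The derivative in \<open>s\<close> is again a function restricted to the line, namely
  the directional derivative of \<open>f\<close>, so the induction over arbitrary \<open>f\<close>
  closes. It provides the curves that witness tangent vectors.\<close>

lemma Ck_on_line:
  assumes "open U"
  shows "Ck_on k U f \<Longrightarrow> Ck_on k {s. x + s *\<^sub>R u \<in> U} (\<lambda>s. f (x + s *\<^sub>R u))"
proof (induction k arbitrary: f)
  case 0
  have "continuous_on {s. x + s *\<^sub>R u \<in> U} (\<lambda>s. f (x + s *\<^sub>R u))"
    by (rule continuous_on_compose2[of U f]) (use 0 in \<open>auto intro!: continuous_intros\<close>)
  then show ?case
    by simp
next
  case (Suc k)
  note op = open_line[OF assms, of x u]
  have der: "((\<lambda>s. f (x + s *\<^sub>R u)) has_derivative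
      (\<lambda>r. r *\<^sub>R frechet_derivative f (at (x + s *\<^sub>R u)) u)) (at s)"
    if "s \<in> {s. x + s *\<^sub>R u \<in> U}" for s
    using has_vector_derivative_chain[OF has_vector_derivative_line Ck_on_has_derivative[OF Suc.prems]]
      that
    by (simp add: has_vector_derivative_def)
  have IH: "Ck_on k {s. x + s *\<^sub>R u \<in> U} (\<lambda>s. frechet_derivative f (at (x + s *\<^sub>R u)) u)"
    using Suc.prems by (intro Suc.IH) simp
  show ?case
    by (rule Ck_on_SucI[OF op der]) (auto intro: Ck_on_scaleR[OF op Ck_on_const IH])
qed

text \<open>With \<open>z\<close> the component of c' orthogonal to \<open>H\<close>, the function
  \<open>c s \<bullet> z\<close> vanishes near \<open>t\<close>. Its derivative is the square of the
  norm of \<open>z\<close>, so \<open>z\<close> is zero.\<close>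

lemma has_vector_derivative_subspace:
  fixes c :: "real \<Rightarrow> 'a::euclidean_space"
  assumes H: "subspace H" and J: "open J" "t \<in> J" "\<And>s. s \<in> J \<Longrightarrow> c s \<in> H"
    and c: "(c has_vector_derivative c') (at t)"
  shows "c' \<in> H"
proof -
  obtain y z where yz: "y \<in> span H" "\<And>w. w \<in> span H \<Longrightarrow> orthogonal z w" "c' = y + z"
    by (rule orthogonal_subspace_decomp_exists[of H c']) blast
  have zH: "w \<bullet> z = 0" if "w \<in> H" for w
    using yz(2)[of w] that span_base by (auto simp: orthogonal_def inner_commute)
  have "((\<lambda>s. c s \<bullet> z) has_vector_derivative c' \<bullet> z) (at t)"
    by (rule has_vector_derivative_chain[OF c bounded_linear_imp_has_derivative[OF
          bounded_linear_inner_left]])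
  then have "((\<lambda>s. 0) has_vector_derivative c' \<bullet> z) (at t)"
    by (rule has_vector_derivative_transform_within_open[OF _ J(1,2)]) (simp add: zH J(3))
  then have "c' \<bullet> z = 0"
    using vector_derivative_unique_at[OF has_vector_derivative_const] by metis
  moreover have "y \<bullet> z = 0"
    using yz(1) by (intro zH) (simp add: span_eq_iff[THEN iffD2, OF H])
  ultimately have "z = 0"
    by (simp add: yz(3) inner_left_distrib)
  then show ?thesis
    using yz(1,3) by (simp add: span_eq_iff[THEN iffD2, OF H])
qed

lemma slice_chartD:
  assumes "slice_chart S H W V \<phi> \<psi>"
  shows "subspace H" "open W" "open V" "Ck_on k W \<phi>" "Ck_on k V \<psi>"
    and "x \<in> W \<Longrightarrow> \<phi> x \<in> V" "x \<in> W \<Longrightarrow> \<psi> (\<phi> x) = x"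
    and "y \<in> V \<Longrightarrow> \<psi> y \<in> W" "y \<in> V \<Longrightarrow> \<phi> (\<psi> y) = y"
    and "x \<in> W \<Longrightarrow> x \<in> S \<longleftrightarrow> \<phi> x \<in> H" "y \<in> V \<Longrightarrow> \<psi> y \<in> S \<longleftrightarrow> y \<in> H"
proof -
  show "subspace H" "open W" "open V" "Ck_on k W \<phi>" "Ck_on k V \<psi>"
    using assms by (auto simp: slice_chart_def smooth_on_open_iff)
  have hom: "homeomorphism W V \<phi> \<psi>" and im: "\<phi> ` (W \<inter> S) = V \<inter> H"
    using assms by (auto simp: slice_chart_def)
  show W: "\<phi> x \<in> V" "\<psi> (\<phi> x) = x" if "x \<in> W" for x
    using hom that by (auto simp: homeomorphism_def)
  show V: "\<psi> y \<in> W" "\<phi> (\<psi> y) = y" if "y \<in> V" for y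
    using hom that by (auto simp: homeomorphism_def)
  show S: "x \<in> S \<longleftrightarrow> \<phi> x \<in> H" if "x \<in> W" for x
  proof
    assume "\<phi> x \<in> H"
    then have "\<phi> x \<in> \<phi> ` (W \<inter> S)"
      using im W(1)[OF that] by blast
    then obtain x' where "x' \<in> W" "x' \<in> S" "\<phi> x = \<phi> x'"
      by auto
    then show "x \<in> S"
      using W(2) that by metis
  qed (use im that in blast)
  show "\<psi> y \<in> S \<longleftrightarrow> y \<in> H" if "y \<in> V"
    using S[of "\<psi> y"] V[OF that] by simp
qed

lemma frechet_derivative_inverse:
  assumes "(f has_derivative f') (at x)" "(g has_derivative g') (at (f x))"
    "open U" "x \<in> U" "\<And>z. z \<in> U \<Longrightarrow> g (f z) = z"
  shows "g' (f' v) = v"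
proof -
  have "((\<lambda>z. z) has_derivative (\<lambda>v. g' (f' v))) (at x)"
    by (rule has_derivative_transform_within_open[OF has_derivative_compose[OF assms(1,2)] assms(3,4)])
      (rule assms(5))
  from fun_cong[OF has_derivative_unique[OF this has_derivative_ident], of v] show ?thesis .
qed

lemma slice_chart_has_derivative:
  assumes "slice_chart S H W V \<phi> \<psi>"
  shows "x \<in> W \<Longrightarrow> (\<phi> has_derivative frechet_derivative \<phi> (at x)) (at x)"
    and "y \<in> V \<Longrightarrow> (\<psi> has_derivative frechet_derivative \<psi> (at y)) (at y)"
  using Ck_on_has_derivative slice_chartD(4,5)[OF assms] by blast+

lemma slice_chart_derivative_inverse:
  assumes ch: "slice_chart S H W V \<phi> \<psi>" and y: "y \<in> V"
  shows "frechet_derivative \<phi> (at (\<psi> y)) (frechet_derivative \<psi> (at y) u) = u"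
    and "frechet_derivative \<psi> (at y) (frechet_derivative \<phi> (at (\<psi> y)) v) = v"
proof -
  note \<psi> = slice_chart_has_derivative(2)[OF ch y]
    and \<phi> = slice_chart_has_derivative(1)[OF ch slice_chartD(8)[OF ch y]]
  show "frechet_derivative \<phi> (at (\<psi> y)) (frechet_derivative \<psi> (at y) u) = u"
    by (rule frechet_derivative_inverse[OF \<psi> \<phi> slice_chartD(3)[OF ch] y slice_chartD(9)[OF ch]])
  show "frechet_derivative \<psi> (at y) (frechet_derivative \<phi> (at (\<psi> y)) v) = v"
    by (rule frechet_derivative_inverse[OF \<phi> _ slice_chartD(2)[OF ch] slice_chartD(8)[OF ch y]
          slice_chartD(7)[OF ch]])
      (simp add: slice_chartD(9)[OF ch y] \<psi>)
qed

text \<open>Lines in \<open>H\<close> through \<open>y\<close> are carried by \<open>\<psi>\<close>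
  to curves in \<open>S\<close>; conversely \<open>\<phi>\<close> sends curves in \<open>S\<close>
  into \<open>H\<close>, where velocities stay in \<open>H\<close>.\<close>

lemma slice_chart_tangent_space:
  assumes ch: "slice_chart S H W V \<phi> \<psi>" and y: "y \<in> V" "y \<in> H"
  shows "frechet_derivative \<psi> (at y) ` H = tangent_space S (\<psi> y)"
proof (intro equalityI subsetI)
  fix v assume "v \<in> frechet_derivative \<psi> (at y) ` H"
  then obtain u where u: "u \<in> H" "v = frechet_derivative \<psi> (at y) u"
    by blast
  let ?\<gamma> = "\<lambda>s. \<psi> (y + s *\<^sub>R u)" and ?J = "{s. y + s *\<^sub>R u \<in> V}"
  obtain e where e: "e > 0" "{-e<..<e} \<subseteq> ?J"
    using open_real_interval_0[OF open_line[OF slice_chartD(3)[OF ch]], of y u] y by auto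
  have "Ck_on k ?J ?\<gamma>" for k
    by (rule Ck_on_line[OF slice_chartD(3,5)[OF ch]])
  then have "smooth_on {-e<..<e} ?\<gamma>"
    using Ck_on_subset[OF _ e(2)] by (auto simp: smooth_on_open_iff)
  moreover have "?\<gamma> ` {-e<..<e} \<subseteq> S"
    using e(2) slice_chartD(1,11)[OF ch] u(1) y(2)
    by (auto simp: subset_eq subspace_add subspace_scale)
  moreover have "(?\<gamma> has_vector_derivative v) (at 0)"
    using has_vector_derivative_chain[OF has_vector_derivative_line, of \<psi> _ y 0 u]
      slice_chart_has_derivative(2)[OF ch y(1)] u(2) by simp
  ultimately show "v \<in> tangent_space S (\<psi> y)"
    using e(1) by (auto simp: tangent_space_def intro!: exI[of _ e] exI[of _ ?\<gamma>])
next
  fix v assume "v \<in> tangent_space S (\<psi> y)"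
  then obtain e \<gamma> where e: "e > 0" and sm: "smooth_on {-e<..<e} \<gamma>" and S: "\<gamma> ` {-e<..<e} \<subseteq> S"
    and 0: "\<gamma> 0 = \<psi> y" and der: "(\<gamma> has_vector_derivative v) (at (0::real))"
    by (auto simp: tangent_space_def)
  have yW: "\<psi> y \<in> W"
    by (rule slice_chartD(8)[OF ch y(1)])
  have cont: "continuous_on {-e<..<e} \<gamma>"
    using sm by (simp add: smooth_on_open_iff) (metis Ck_on.simps(1))
  \<comment> \<open>The curve may leave the chart domain, so time is cut down to where it stays in
    \<open>W\<close>.\<close>
  let ?J = "{-e<..<e} \<inter> \<gamma> -` W"
  have J: "open ?J" "0 \<in> ?J"
    using continuous_open_preimage[OF cont open_greaterThanLessThan slice_chartD(2)[OF ch]] e yW 0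
    by auto
  have "((\<lambda>s. \<phi> (\<gamma> s)) has_vector_derivative frechet_derivative \<phi> (at (\<psi> y)) v) (at 0)"
    using has_vector_derivative_chain[OF der] slice_chart_has_derivative(1)[OF ch yW] 0 by simp
  moreover have "\<phi> (\<gamma> s) \<in> H" if "s \<in> ?J" for s
    using S that slice_chartD(10)[OF ch, THEN iffD1, of "\<gamma> s"] by blast
  ultimately have "frechet_derivative \<phi> (at (\<psi> y)) v \<in> H"
    using has_vector_derivative_subspace[OF slice_chartD(1)[OF ch] J, of "\<lambda>s. \<phi> (\<gamma> s)"] by blast
  then show "v \<in> frechet_derivative \<psi> (at y) ` H"
    using slice_chart_derivative_inverse(2)[OF ch y(1), of v] by (metis imageI)
qed

lemma slice_chart_open: "open M \<Longrightarrow> slice_chart M UNIV M M (\<lambda>x. x) (\<lambda>x. x)"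
  by (auto simp: slice_chart_def smooth_on_open_iff Ck_on_id homeomorphism_def)

lemma embedded_submanifold_open: "open M \<Longrightarrow> embedded_submanifold M"
  unfolding embedded_submanifold_def using slice_chart_open by blast

lemma tangent_space_open:
  assumes "open M" "p \<in> M"
  shows "tangent_space M p = UNIV"
  using slice_chart_tangent_space[OF slice_chart_open[OF assms(1)] assms(2)] by simp

text \<open>Translates velocity and acceleration between \<open>\<gamma>\<close> and its chart
  representation \<open>c\<close>. The acceleration is not tensorial: differentiating the
  pushed-forward velocity adds a second derivative of \<open>\<psi>\<close>, which the Christoffel
  form of the chart later absorbs.\<close>

lemma slice_chart_curve:
  assumes ch: "slice_chart S H W V \<phi> \<psi>"
    and I: "open I" "t \<in> I" and \<gamma>: "Ck_on 2 I \<gamma>" "\<gamma> ` I \<subseteq> S" "\<gamma> t \<in> W"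
  defines "c \<equiv> \<phi> \<circ> \<gamma>"
  defines "c1 \<equiv> vector_derivative c (at t)"
    and "c2 \<equiv> vector_derivative (\<lambda>s. vector_derivative c (at s)) (at t)"
  shows "c1 \<in> H" "c2 \<in> H"
    and "vector_derivative \<gamma> (at t) = frechet_derivative \<psi> (at (c t)) c1"
    and "vector_derivative (\<lambda>s. vector_derivative \<gamma> (at s)) (at t) =
      second_derivative \<psi> (c t) c1 c1 + frechet_derivative \<psi> (at (c t)) c2"
proof -
  let ?J = "I \<inter> \<gamma> -` W" and ?d = "\<lambda>s. vector_derivative \<gamma> (at s)"
  let ?c1 = "\<lambda>s. frechet_derivative \<phi> (at (\<gamma> s)) (?d s)"
  note g = Ck_on_vector_derivative[OF I(1) \<gamma>(1)[unfolded numeral_2_eq_2]]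
  have cont: "continuous_on I \<gamma>"
    using Ck_on_Suc_imp[OF Ck_on_Suc_imp[OF \<gamma>(1)[unfolded numeral_2_eq_2]]] by simp
  have J: "open ?J" "t \<in> ?J" "?J \<subseteq> I"
    using continuous_open_preimage[OF cont I(1) slice_chartD(2)[OF ch]] I(2) \<gamma>(3) by auto
  have c_der: "(c has_vector_derivative ?c1 s) (at s)" if "s \<in> ?J" for s
    unfolding c_def comp_def
    using has_vector_derivative_chain[OF g(1) slice_chart_has_derivative(1)[OF ch, of "\<gamma> s"]] that
    by auto
  have c_vd: "vector_derivative c (at s) = ?c1 s" if "s \<in> ?J" for s
    by (rule vector_derivative_at[OF c_der[OF that]])
  have cH: "c s \<in> H \<and> c s \<in> V" if "s \<in> ?J" for s
    using \<gamma>(2) that slice_chartD(6)[OF ch, of "\<gamma> s"] slice_chartD(10)[OF ch, THEN iffD1, of "\<gamma> s"]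
    unfolding c_def comp_def by blast
  have c1H: "?c1 s \<in> H" if "s \<in> ?J" for s
    by (rule has_vector_derivative_subspace[OF slice_chartD(1)[OF ch] J(1) that _ c_der[OF that]])
      (simp add: cH)
  show "c1 \<in> H"
    using c1H[OF J(2)] c_vd[OF J(2)] by (simp add: c1_def)
  have d2: "(?d has_vector_derivative vector_derivative ?d (at t)) (at t)"
    by (rule Ck_on_vector_derivative(1)[OF I(1) g(2) I(2)])
  \<comment> \<open>Expressing c' through \<open>\<phi>\<close> shows that it is differentiable; the
    formula for the acceleration is then computed through \<open>\<psi>\<close>.\<close>
  obtain a where a: "(?c1 has_vector_derivative a) (at t)"
    using has_vector_derivative_frechet_derivative[OF slice_chartD(4,2)[OF ch] J(1,2) _
        g(1)[OF I(2)] d2] by auto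
  have c1_der: "((\<lambda>s. vector_derivative c (at s)) has_vector_derivative a) (at t)"
    by (rule has_vector_derivative_transform_within_open[OF a J(1,2)]) (simp add: c_vd)
  then have ca: "c2 = a"
    by (simp add: c2_def vector_derivative_at)
  show "c2 \<in> H"
    unfolding ca
    by (rule has_vector_derivative_subspace[OF slice_chartD(1)[OF ch] J(1,2) _ a]) (rule c1H)
  have \<gamma>1: "?d s = frechet_derivative \<psi> (at (c s)) (vector_derivative c (at s))" if "s \<in> ?J" for s
    using slice_chart_derivative_inverse(2)[OF ch, of "c s" "?d s"] cH[OF that] that
      slice_chartD(7)[OF ch] by (simp add: c_vd[OF that]) (simp add: c_def)
  show "?d t = frechet_derivative \<psi> (at (c t)) c1"
    unfolding c1_def by (rule \<gamma>1[OF J(2)])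
  have "((\<lambda>s. frechet_derivative \<psi> (at (c s)) (vector_derivative c (at s))) has_vector_derivative
      second_derivative \<psi> (c t) c1 c1 + frechet_derivative \<psi> (at (c t)) a) (at t)"
    using has_vector_derivative_frechet_derivative[OF slice_chartD(5,3)[OF ch] J(1,2) _
        c_der[OF J(2)] c1_der] cH c_vd[OF J(2)]
    by (simp add: c1_def image_subset_iff)
  then have "(?d has_vector_derivative
      second_derivative \<psi> (c t) c1 c1 + frechet_derivative \<psi> (at (c t)) a) (at t)"
    by (rule has_vector_derivative_transform_within_open[OF _ J(1,2)]) (simp add: \<gamma>1)
  then show "vector_derivative ?d (at t) =
      second_derivative \<psi> (c t) c1 c1 + frechet_derivative \<psi> (at (c t)) c2"
    unfolding ca by (rule vector_derivative_at)
qed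

section \<open>The trace metric\<close>

definition gl_christoffel :: "real^'n^'n \<Rightarrow> real^'n^'n \<Rightarrow> real^'n^'n \<Rightarrow> real^'n^'n" where
  "gl_christoffel A V W = - (1 / 2) *\<^sub>R (V ** matrix_inv A ** W + W ** matrix_inv A ** V)"

lemma trace_metric_simps:
  "trace_metric A (U + V) W = trace_metric A U W + trace_metric A V W"
  "trace_metric A U (V + W) = trace_metric A U V + trace_metric A U W"
  "trace_metric A (a *\<^sub>R V) W = a * trace_metric A V W"
  "trace_metric A V (a *\<^sub>R W) = a * trace_metric A V W"
  by (simp_all add: trace_metric_def matrix_mult_linear_simps trace_linear_simps)

lemma trace_metric_commute: "trace_metric A V W = trace_metric A W V"
  unfolding trace_metric_def
  using trace_mul_sym[of "matrix_inv A ** V" "matrix_inv A ** W"] by (simp add: matrix_mul_assoc)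

lemma trace_metric_translate:
  fixes A :: "real^'n^'n"
  assumes "invertible A"
  shows "trace_metric A (A ** V) (A ** W) = trace_metric (mat 1) V W"
proof -
  have "matrix_inv (mat 1) = (mat 1 :: real^'n^'n)"
    by (rule matrix_inv_eqI) simp
  then show ?thesis
    using assms by (simp add: trace_metric_def matrix_mul_assoc)
qed

text \<open>Metric compatibility for fields along a curve. This form serves constant fields on
  \<open>GL\<close> as well as the moving fields that arise from a chart.\<close>

lemma has_real_derivative_trace_metric:
  fixes c V W :: "real \<Rightarrow> real^'n^'n"
  assumes c: "(c has_vector_derivative c') (at t)" "invertible (c t)"
    and V: "(V has_vector_derivative V') (at t)" and W: "(W has_vector_derivative W') (at t)"
  shows "((\<lambda>s. trace_metric (c s) (V s) (W s)) has_real_derivative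
    trace_metric (c t) (V' + gl_christoffel (c t) c' (V t)) (W t) +
    trace_metric (c t) (V t) (W' + gl_christoffel (c t) c' (W t))) (at t)"
proof -
  let ?A = "matrix_inv (c t)"
  note inv = has_vector_derivative_matrix_inv[OF c]
  have "((\<lambda>s. trace (matrix_inv (c s) ** V s ** matrix_inv (c s) ** W s)) has_vector_derivative
      trace (?A ** V t ** ?A ** W' +
        (?A ** V t ** - (?A ** c' ** ?A) + (?A ** V' + - (?A ** c' ** ?A) ** V t) ** ?A) ** W t)) (at t)"
    by (intro has_vector_derivative_chain[OF _ bounded_linear_imp_has_derivative[OF
          bounded_linear_trace]] has_vector_derivative_matrix_mult inv V W)
  \<comment> \<open>One of the two halves in the correction of \<open>W\<close> ends in A^-1 c';
    cyclicity brings it to the front, where it completes the term from the first inverse.\<close>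
  moreover have "trace (?A ** V t ** ?A ** W t ** ?A ** c') = trace (?A ** c' ** ?A ** V t ** ?A ** W t)"
    using trace_mul_sym[of "?A ** V t ** ?A ** W t" "?A ** c'"] by (simp add: matrix_mul_assoc)
  then have "trace (?A ** V t ** ?A ** W' +
        (?A ** V t ** - (?A ** c' ** ?A) + (?A ** V' + - (?A ** c' ** ?A) ** V t) ** ?A) ** W t) =
      trace_metric (c t) (V' + gl_christoffel (c t) c' (V t)) (W t) +
      trace_metric (c t) (V t) (W' + gl_christoffel (c t) c' (W t))"
    unfolding trace_metric_def gl_christoffel_def
    by (simp add: matrix_mult_linear_simps trace_linear_simps matrix_mul_assoc field_simps)
  ultimately show ?thesis
    unfolding has_real_derivative_iff_has_vector_derivative by (simp add: trace_metric_def)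
qed

text \<open>The form is in general indefinite. With B = A^-1 V, pairing \<open>V\<close> with A B^T
  gives tr(B B^T), the squared norm of B. Transposition preserves the trace, so the same test vector
  is tangent to \<open>SL\<close> whenever \<open>V\<close> is, and nondegeneracy passes to the
  restriction.\<close>

lemma nondegenerate_trace_metric:
  assumes A: "invertible A"
  shows "nondegenerate_form UNIV (trace_metric A)"
    and "nondegenerate_form {V. trace (matrix_inv A ** V) = 0} (trace_metric A)"
proof -
  have zero: "V = 0" if "trace_metric A V (A ** transpose (matrix_inv A ** V)) = 0" for V
  proof -
    have "matrix_inv A ** V = 0"
      using that A trace_matrix_mult_transpose[of "matrix_inv A ** V"]
      by (simp add: trace_metric_def matrix_mul_assoc)
    then have "A ** (matrix_inv A ** V) = 0"
      by simp
    then show ?thesis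
      using A by (simp add: matrix_mul_assoc)
  qed
  show "nondegenerate_form UNIV (trace_metric A)"
    unfolding nondegenerate_form_def using zero trace_metric_commute[of A]
    by (auto simp: trace_metric_simps)
  have "trace (matrix_inv A ** (A ** transpose (matrix_inv A ** V))) = 0"
    if "trace (matrix_inv A ** V) = 0" for V
    using that A by (simp add: matrix_mul_assoc trace_transpose)
  then show "nondegenerate_form {V. trace (matrix_inv A ** V) = 0} (trace_metric A)"
    unfolding nondegenerate_form_def using zero trace_metric_commute[of A]
    by (auto simp: trace_metric_simps)
qed

lemma christoffel_trace_metric:
  assumes "invertible A"
  shows "christoffel UNIV trace_metric A V W = gl_christoffel A V W"
proof (rule christoffel_eq)
  have "((\<lambda>s. trace_metric (A + s *\<^sub>R U) V W) has_real_derivative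
      trace_metric A (gl_christoffel A U V) W + trace_metric A V (gl_christoffel A U W)) (at 0)"
    for U V W
    using has_real_derivative_trace_metric[OF has_vector_derivative_line[of A U 0] _
        has_vector_derivative_const[of V] has_vector_derivative_const[of W]] assms
    by simp
  then show "levi_civita_form UNIV trace_metric A (gl_christoffel A)"
    unfolding levi_civita_form_def
    by (auto simp: DERIV_imp_deriv gl_christoffel_def add.commute)
qed (use nondegenerate_trace_metric(1)[OF assms] in auto)

section \<open>The special linear group\<close>

text \<open>One inclusion is Jacobi's formula for a curve of constant determinant, the other uses
  the curve A exp(s A^-1 V). The open set \<open>N\<close> is carried along because total geodesy is
  stated for fields tangent to \<open>N \<inter> S\<close>.\<close>

lemma tangent_space_SL:
  assumes N: "open N" and A: "A \<in> N \<inter> SL"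
  shows "tangent_space (N \<inter> SL) A = {V. trace (matrix_inv A ** V) = 0}"
proof (intro equalityI subsetI)
  have inv: "invertible A"
    using A invertible_SL by auto
  {
    fix V assume "V \<in> tangent_space (N \<inter> SL) A"
    then obtain e \<gamma> where e: "e > 0" and \<gamma>: "\<gamma> ` {-e<..<e} \<subseteq> N \<inter> SL" "\<gamma> 0 = A"
      and der: "(\<gamma> has_vector_derivative V) (at (0::real))"
      by (auto simp: tangent_space_def)
    have "((\<lambda>s. det (\<gamma> s)) has_vector_derivative det A * trace (matrix_inv A ** V)) (at 0)"
      using has_real_derivative_det[OF der] inv \<gamma>(2)
      by (simp add: has_real_derivative_iff_has_vector_derivative)
    then have "((\<lambda>s. 1) has_vector_derivative det A * trace (matrix_inv A ** V)) (at (0::real))"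
      by (rule has_vector_derivative_transform_within_open[OF _ open_greaterThanLessThan[of "-e" e]])
        (use e \<gamma>(1) in \<open>auto simp: SL_def image_subset_iff\<close>)
    then show "V \<in> {V. trace (matrix_inv A ** V) = 0}"
      using vector_derivative_unique_at[OF _ has_vector_derivative_const] A by (auto simp: SL_def)
  }
  fix V assume V: "V \<in> {V. trace (matrix_inv A ** V) = 0}"
  let ?\<gamma> = "\<lambda>s. A ** matrix_exp (s *\<^sub>R (matrix_inv A ** V))"
  have sm: "Ck_on k UNIV ?\<gamma>" for k
    by (rule Ck_on_matrix_exp) simp
  have "open (?\<gamma> -` N)"
    using open_vimage[OF N] sm[of 0] by simp
  then obtain e where e: "e > 0" "{-e<..<e} \<subseteq> ?\<gamma> -` N"
    using open_real_interval_0[of "?\<gamma> -` N"] A by auto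
  have "(?\<gamma> has_vector_derivative A ** (matrix_inv A ** V ** matrix_exp 0)) (at 0)"
    using has_vector_derivative_matrix_mult[OF has_vector_derivative_const[of A]
        has_vector_derivative_matrix_exp[of "matrix_inv A ** V" 0]] by simp
  moreover have "smooth_on {-e<..<e} ?\<gamma>"
    using Ck_on_subset[OF sm] by (auto simp: smooth_on_open_iff)
  moreover have "?\<gamma> ` {-e<..<e} \<subseteq> N \<inter> SL"
    using e(2) A V by (auto simp: SL_def det_mul det_matrix_exp)
  ultimately show "V \<in> tangent_space (N \<inter> SL) A"
    using e(1) inv unfolding tangent_space_def
    by (intro CollectI exI[of _ e] conjI exI[of _ ?\<gamma>]) (simp_all add: matrix_mul_assoc)
qed

lemmas tangent_space_SL_UNIV = tangent_space_SL[OF open_UNIV, simplified]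

lemma subspace_trace_eq_0: "subspace {V :: real^'n^'n. trace (B ** V) = 0}"
  by (auto simp: subspace_def matrix_mult_linear_simps trace_linear_simps)

lemma tangent_covariant_derivative_SL:
  assumes J: "open J" "t \<in> J" and c: "c ` J \<subseteq> SL" "(c has_vector_derivative c') (at t)"
    and V: "\<And>s. s \<in> J \<Longrightarrow> V s \<in> tangent_space SL (c s)" "(V has_vector_derivative V') (at t)"
  shows "V' + gl_christoffel (c t) c' (V t) \<in> tangent_space SL (c t)"
proof -
  have SL: "c s \<in> SL" and tan: "trace (matrix_inv (c s) ** V s) = 0" if "s \<in> J" for s
    using c(1) V(1)[OF that] that by (auto simp: tangent_space_SL_UNIV)
  note ct = SL[OF J(2)]
  let ?A = "matrix_inv (c t)"
  have "((\<lambda>s. trace (matrix_inv (c s) ** V s)) has_vector_derivative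
      trace (?A ** V' + - (?A ** c' ** ?A) ** V t)) (at t)"
    by (intro has_vector_derivative_chain[OF _ bounded_linear_imp_has_derivative[OF
          bounded_linear_trace]] has_vector_derivative_matrix_mult
        has_vector_derivative_matrix_inv c(2) V(2) invertible_SL ct)
  then have "((\<lambda>s. 0) has_vector_derivative trace (?A ** V' + - (?A ** c' ** ?A) ** V t)) (at t)"
    by (rule has_vector_derivative_transform_within_open[OF _ J]) (rule tan)
  then have "trace (?A ** V' + - (?A ** c' ** ?A) ** V t) = 0"
    using vector_derivative_unique_at[OF _ has_vector_derivative_const] by blast
  \<comment> \<open>Cyclicity makes the two halves of \<open>gl_christoffel\<close> equal after
    multiplying by A^-1 and taking the trace; together they match the derivative of the
    inverse.\<close>
  moreover have "trace (?A ** V t ** ?A ** c') = trace (?A ** c' ** ?A ** V t)"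
    using trace_mul_sym[of "?A ** V t" "?A ** c'"] by (simp add: matrix_mul_assoc)
  ultimately show ?thesis
    using ct
    by (simp add: tangent_space_SL_UNIV gl_christoffel_def matrix_mult_linear_simps
        trace_linear_simps matrix_mul_assoc)
qed

section \<open>Slice charts of the special linear group from cofactors\<close>

definition set_entry :: "'n \<Rightarrow> 'n \<Rightarrow> real^'n^'n \<Rightarrow> real \<Rightarrow> real^'n^'n" where
  "set_entry a b X c = X + (c - X $ a $ b) *\<^sub>R axis a (axis b 1)"

text \<open>The usual signed cofactor, encoded as the increment of the determinant when the entry
  goes from 0 to 1. In this form its independence of that entry and its smoothness are
  immediate.\<close>

definition cofactor :: "'n \<Rightarrow> 'n \<Rightarrow> real^'n^'n \<Rightarrow> real" where
  "cofactor a b X = det (set_entry a b X 1) - det (set_entry a b X 0)"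

lemma set_entry_simps [simp]:
  "set_entry a b X c $ a $ b = c"
  "set_entry a b (set_entry a b X c) d = set_entry a b X d"
  "set_entry a b X (X $ a $ b) = X"
  by (simp_all add: set_entry_def vec_eq_iff axis_def)

lemma cofactor_set_entry [simp]: "cofactor a b (set_entry a b X c) = cofactor a b X"
  by (simp add: cofactor_def)

lemma det_set_entry: "det (set_entry a b X c) = c * cofactor a b X + det (set_entry a b X 0)"
proof -
  define r where "r = set_entry a b X 0 $ a"
  let ?M = "\<lambda>v. \<chi> i. if i = a then v else X $ i"
  \<comment> \<open>Only row \<open>a\<close> depends on \<open>c\<close>, and it does so affinely;
    linearity of the determinant in that row finishes the argument.\<close>
  have eq: "set_entry a b X c = ?M (c *s axis b 1 + r)" for c
    by (simp add: r_def set_entry_def vec_eq_iff axis_def algebra_simps)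
  have "det (set_entry a b X c) = c * det (?M (axis b 1)) + det (?M r)" for c
    unfolding eq det_row_add det_row_mul ..
  then show ?thesis
    by (simp add: cofactor_def)
qed

lemma Ck_on_set_entry:
  assumes "open U" "Ck_on k U f"
  shows "Ck_on k U (\<lambda>X. set_entry a b X (f X))"
  unfolding set_entry_def
  by (intro Ck_on_add Ck_on_scaleR Ck_on_diff Ck_on_id Ck_on_const assms
      Ck_on_linear[OF assms(1) bounded_linear_entry])

lemma Ck_on_cofactor: "open U \<Longrightarrow> Ck_on k U (cofactor a b)"
  unfolding cofactor_def by (intro Ck_on_diff Ck_on_det Ck_on_set_entry Ck_on_const)

text \<open>The determinant is affine in the entry \<open>(a, b)\<close> with slope the cofactor, so wherever the
  cofactor does not vanish that entry can be replaced by \<open>det X - 1\<close> as a coordinate.\<close>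

lemma slice_chart_SL:
  fixes a b :: "'n::finite"
  defines "W \<equiv> {X :: real^'n^'n. cofactor a b X \<noteq> 0}"
  shows "slice_chart SL {Y. Y $ a $ b = 0} W W
    (\<lambda>X. set_entry a b X (det X - 1))
    (\<lambda>Y. set_entry a b Y ((Y $ a $ b + 1 - det (set_entry a b Y 0)) / cofactor a b Y))"
    (is "slice_chart SL ?H W W ?\<phi> ?\<psi>")
proof -
  have "continuous_on UNIV (cofactor a b)"
    using Ck_on_cofactor[OF open_UNIV, of 0] by simp
  then have W: "open W"
    using open_vimage[OF open_Compl[OF closed_singleton], of "cofactor a b" 0]
    by (simp add: W_def Compl_eq)
  have \<phi>: "Ck_on k W ?\<phi>" for k
    by (intro Ck_on_set_entry Ck_on_diff Ck_on_det Ck_on_id Ck_on_const W)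
  have \<psi>: "Ck_on k W ?\<psi>" for k
    by (intro Ck_on_set_entry Ck_on_divide Ck_on_cofactor Ck_on_diff Ck_on_add Ck_on_det Ck_on_const
        Ck_on_linear[OF W bounded_linear_entry] W) (simp add: W_def)
  \<comment> \<open>\<open>W\<close> is both source and target because overwriting the entry leaves
    the cofactor unchanged.\<close>
  have \<phi>W: "?\<phi> X \<in> W" "?\<psi> (?\<phi> X) = X" if "X \<in> W" for X
  proof -
    show "?\<phi> X \<in> W"
      using that by (simp add: W_def)
    \<comment> \<open>Solves the affine relation \<open>det_set_entry\<close> for the overwritten
      entry, which is how \<open>?\<psi>\<close> recovers \<open>X\<close>.\<close>
    have "(det X - det (set_entry a b X 0)) / cofactor a b X = X $ a $ b"
      using det_set_entry[of a b X "X $ a $ b"] that by (simp add: W_def)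
    then show "?\<psi> (?\<phi> X) = X"
      by simp
  qed
  have \<psi>W: "?\<psi> Y \<in> W" "?\<phi> (?\<psi> Y) = Y" and det: "det (?\<psi> Y) = Y $ a $ b + 1" if "Y \<in> W" for Y
  proof -
    show "?\<psi> Y \<in> W"
      using that by (simp add: W_def)
    show "det (?\<psi> Y) = Y $ a $ b + 1"
      using that by (subst det_set_entry) (simp add: W_def)
    then show "?\<phi> (?\<psi> Y) = Y"
      by simp
  qed
  have "homeomorphism W W ?\<phi> ?\<psi>"
    using \<phi>[of 0] \<psi>[of 0] \<phi>W \<psi>W by (intro homeomorphismI) auto
  moreover have "?\<phi> ` (W \<inter> SL) = W \<inter> ?H"
  proof (intro equalityI subsetI)
    fix Y assume "Y \<in> W \<inter> ?H"
    then have Y: "Y \<in> W" "Y $ a $ b = 0"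
      by auto
    show "Y \<in> ?\<phi> ` (W \<inter> SL)"
    proof (rule image_eqI[where x = "?\<psi> Y"])
      show "?\<psi> Y \<in> W \<inter> SL"
        using \<psi>W(1)[OF Y(1)] det[OF Y(1)] by (simp add: SL_def Y(2))
    qed (rule \<psi>W(2)[OF Y(1), symmetric])
  qed (auto simp: SL_def W_def)
  moreover have "subspace ?H"
    by (auto simp: subspace_def)
  ultimately show ?thesis
    using W \<phi> \<psi> by (simp add: slice_chart_def smooth_on_open_iff)
qed

text \<open>The derivative of det at \<open>A\<close> along the matrix unit of position (a, b) is
  the cofactor, and by Jacobi's formula also the entry (b, a) of the inverse. An inverse matrix has
  a nonzero entry.\<close>

lemma cofactor_nonzero:
  fixes A :: "real^'n^'n"
  assumes A: "A \<in> SL"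
  obtains a b where "cofactor a b A \<noteq> 0"
proof -
  have inv: "invertible A"
    by (rule invertible_SL[OF A])
  have "matrix_inv A \<noteq> 0"
    using matrix_inv_mult(1)[OF inv] by (metis det_0 det_I mat_0 times0_right zero_neq_one)
  then obtain a b where ab: "matrix_inv A $ b $ a \<noteq> 0"
    by (auto simp: vec_eq_iff)
  let ?E = "axis a (axis b 1) :: real^'n^'n"
  have eq: "A + s *\<^sub>R ?E = set_entry a b A (A $ a $ b + s)" for s
    by (simp add: set_entry_def)
  have "det (A + s *\<^sub>R ?E) = (A $ a $ b + s) * cofactor a b A + det (set_entry a b A 0)" for s
    unfolding eq by (rule det_set_entry)
  then have "((\<lambda>s. det (A + s *\<^sub>R ?E)) has_real_derivative cofactor a b A) (at 0)"
    by (simp only:) (auto intro!: derivative_eq_intros)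
  moreover have "((\<lambda>s. det (A + s *\<^sub>R ?E)) has_real_derivative trace (matrix_inv A ** ?E)) (at 0)"
    using has_real_derivative_det[OF has_vector_derivative_line[of A ?E 0]] inv A
    by (simp add: SL_def)
  moreover have "trace (matrix_inv A ** ?E) = matrix_inv A $ b $ a"
  proof -
    have "?E $ k $ i = (if k = a then if i = b then 1 else 0 else 0)" for k i
      by (simp add: axis_def)
    then show ?thesis
      by (simp add: trace_def matrix_matrix_mult_def mult_delta_right)
  qed
  ultimately have "cofactor a b A \<noteq> 0"
    using DERIV_unique[of "\<lambda>s. det (A + s *\<^sub>R ?E)" _ 0] ab by fastforce
  then show ?thesis
    by (rule that)
qed

lemma slice_chart_SL_exists:
  fixes A :: "real^'n^'n"
  assumes "A \<in> SL"
  shows "\<exists>H W V \<phi> \<psi>. slice_chart SL H W V \<phi> \<psi> \<and> A \<in> W \<and> dim H = DIM(real^'n^'n) - 1"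
proof -
  obtain a b where ab: "cofactor a b A \<noteq> 0"
    by (rule cofactor_nonzero[OF assms])
  have "{Y :: real^'n^'n. Y $ a $ b = 0} = {Y. axis a (axis b 1) \<bullet> Y = 0}"
    by (simp add: inner_axis')
  moreover have "axis a (axis b 1) \<noteq> (0 :: real^'n^'n)"
    by (simp add: axis_eq_0_iff)
  ultimately have "dim {Y :: real^'n^'n. Y $ a $ b = 0} = DIM(real^'n^'n) - 1"
    by (metis dim_hyperplane)
  then show ?thesis
    using slice_chart_SL[of a b] ab by blast
qed

section \<open>Constancy of the index and the semi-Riemannian structures\<close>

lemma form_index_image:
  fixes f :: "'a::euclidean_space \<Rightarrow> 'b::euclidean_space"
  assumes f: "linear f" "inj f" and b: "\<And>v. b' (f v) (f v) = b v v"
  shows "form_index (f ` T) b' = form_index T b"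
proof -
  \<comment> \<open>Images and preimages under \<open>f\<close> match the negative definite
    subspaces with equal dimensions, so \<open>Max\<close> is taken over the same set.\<close>
  have "{dim F | F. subspace F \<and> F \<subseteq> f ` T \<and> (\<forall>v\<in>F. v \<noteq> 0 \<longrightarrow> b' v v < 0)} =
      {dim F | F. subspace F \<and> F \<subseteq> T \<and> (\<forall>v\<in>F. v \<noteq> 0 \<longrightarrow> b v v < 0)}" (is "?L = ?R")
  proof (intro equalityI subsetI)
    fix d assume "d \<in> ?R"
    then obtain F where F: "subspace F" "F \<subseteq> T" "\<And>v. v \<in> F \<Longrightarrow> v \<noteq> 0 \<Longrightarrow> b v v < 0" "d = dim F"
      by blast
    have "subspace (f ` F)" "f ` F \<subseteq> f ` T" "dim (f ` F) = d"
      using F f dim_image_eq[OF f(1) inj_on_subset[OF f(2)]]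
      by (auto intro: linear_subspace_image)
    moreover have "\<forall>v\<in>f ` F. v \<noteq> 0 \<longrightarrow> b' v v < 0"
      using F(3) b linear_0[OF f(1)] by auto
    ultimately show "d \<in> ?L"
      by blast
  next
    fix d assume "d \<in> ?L"
    then obtain F where F: "subspace F" "F \<subseteq> f ` T" "\<And>v. v \<in> F \<Longrightarrow> v \<noteq> 0 \<Longrightarrow> b' v v < 0" "d = dim F"
      by blast
    have img: "f ` (f -` F) = F"
      using F(2) by blast
    have "subspace (f -` F)" "f -` F \<subseteq> T" "dim (f -` F) = d"
      using F(1,2,4) f(2) dim_image_eq[OF f(1) inj_on_subset[OF f(2)], of "f -` F"] img
      by (auto intro: linear_subspace_vimage[OF f(1)] dest: injD)
    moreover have "\<forall>v\<in>f -` F. v \<noteq> 0 \<longrightarrow> b v v < 0"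
      using F(3) b linear_injective_0[OF f(1)] f(2) by (metis vimage_eq)
    ultimately show "d \<in> ?R"
      by blast
  qed
  then show ?thesis
    by (simp add: form_index_def)
qed

text \<open>Left translation by \<open>A\<close> is an isometry from \<open>T\<close>, the tangent
  space at the identity in both applications, onto the tangent space at \<open>A\<close>. Hence the
  index does not depend on \<open>A\<close>.\<close>

lemma metric_tensor_trace_metric:
  fixes S :: "(real^'n^'n) set"
  assumes S: "S \<subseteq> GL"
    and nd: "\<And>A. A \<in> S \<Longrightarrow> nondegenerate_form (tangent_space S A) (trace_metric A)"
    and T: "\<And>A. A \<in> S \<Longrightarrow> tangent_space S A = (**) A ` T"
  shows "metric_tensor S trace_metric"
  unfolding metric_tensor_iff
proof (intro conjI ballI allI impI nd)
  fix X Y :: "real^'n^'n \<Rightarrow> real^'n^'n" assume XY: "tangent_field S X \<and> tangent_field S Y"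
  show "smooth_on S (\<lambda>p. trace_metric p (X p) (Y p))"
    unfolding smooth_on_def
  proof
    fix p assume p: "p \<in> S"
    obtain N F where F: "open N" "p \<in> N" "\<And>k. Ck_on k N F" "\<And>x. x \<in> N \<inter> S \<Longrightarrow> F x = X x"
      using XY p unfolding tangent_field_def smooth_on_def by meson
    obtain N' F' where F': "open N'" "p \<in> N'" "\<And>k. Ck_on k N' F'" "\<And>x. x \<in> N' \<inter> S \<Longrightarrow> F' x = Y x"
      using XY p unfolding tangent_field_def smooth_on_def by meson
    \<comment> \<open>Both local extensions live here, and the intersection with \<open>GL\<close>
      makes inversion smooth.\<close>
    let ?N = "N \<inter> N' \<inter> GL"
    have N: "open ?N"
      using F(1) F'(1) open_GL by blast
    have "Ck_on k ?N F" "Ck_on k ?N F'" for k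
      by (rule Ck_on_subset[OF F(3)], blast) (rule Ck_on_subset[OF F'(3)], blast)
    then have "Ck_on k ?N (\<lambda>x. trace_metric x (F x) (F' x))" for k
      unfolding trace_metric_def
      by (intro Ck_on_bounded_linear[OF N bounded_linear_trace] Ck_on_matrix_mult
          Ck_on_matrix_inv Ck_on_id N) (auto simp: GL_def)
    then show "\<exists>N G. open N \<and> p \<in> N \<and> (\<forall>k. Ck_on k N G) \<and>
        (\<forall>x\<in>N \<inter> S. G x = trace_metric x (X x) (Y x))"
      using N F(2,4) F'(2,4) p S
      by (intro exI[of _ ?N] exI[of _ "\<lambda>x. trace_metric x (F x) (F' x)"]) auto
  qed
next
  have "form_index (tangent_space S A) (trace_metric A) = form_index T (trace_metric (mat 1))"
    if "A \<in> S" for A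
  proof -
    have A: "invertible A"
      using that S by (auto simp: GL_def)
    have "inj ((**) A :: real^'n^'n \<Rightarrow> _)"
      by (rule inj_on_inverseI[of _ "(**) (matrix_inv A)"]) (simp add: A matrix_mul_assoc)
    then show ?thesis
      unfolding T[OF that]
      by (intro form_index_image trace_metric_translate A bounded_linear.linear
          bounded_bilinear.bounded_linear_right[OF bounded_bilinear_matrix_mult])
  qed
  then show "\<exists>\<nu>. \<forall>A\<in>S. form_index (tangent_space S A) (trace_metric A) = \<nu>"
    by blast
qed

lemma nondegenerate_trace_metric_SL:
  "A \<in> SL \<Longrightarrow> nondegenerate_form (tangent_space SL A) (trace_metric A)"
  by (simp add: tangent_space_SL_UNIV nondegenerate_trace_metric invertible_SL)

lemma semi_riemannian_manifold_GL:
  "semi_riemannian_manifold (GL :: (real^'n^'n) set) trace_metric"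
proof -
  have "tangent_space GL A = (**) A ` UNIV" if "A \<in> GL" for A :: "real^'n^'n"
  proof -
    have "surj ((**) A :: real^'n^'n \<Rightarrow> _)"
      using that by (intro surjI[of _ "(**) (matrix_inv A)"]) (simp add: GL_def matrix_mul_assoc)
    then show ?thesis
      using that by (simp add: tangent_space_open[OF open_GL])
  qed
  moreover have "nondegenerate_form (tangent_space GL A) (trace_metric A)" if "A \<in> GL" for A :: "real^'n^'n"
    unfolding tangent_space_open[OF open_GL that]
    using that by (intro nondegenerate_trace_metric) (simp add: GL_def)
  ultimately show ?thesis
    unfolding semi_riemannian_manifold_def
    by (intro conjI embedded_submanifold_open open_GL metric_tensor_trace_metric[where T = UNIV]) auto
qed

lemma semi_riemannian_manifold_SL:
  "semi_riemannian_manifold (SL :: (real^'n^'n) set) trace_metric"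
proof -
  have "tangent_space SL A = (**) A ` {V. trace V = 0}" if "A \<in> SL" for A :: "real^'n^'n"
  proof (intro equalityI subsetI)
    fix V assume "V \<in> tangent_space SL A"
    then show "V \<in> (**) A ` {V. trace V = 0}"
      using invertible_SL[OF that]
      by (intro image_eqI[of _ _ "matrix_inv A ** V"])
        (simp_all add: tangent_space_SL_UNIV[OF that] matrix_mul_assoc)
  qed (use that invertible_SL[OF that] in \<open>auto simp: tangent_space_SL_UNIV matrix_mul_assoc\<close>)
  moreover have "(SL :: (real^'n^'n) set) \<subseteq> GL"
    using invertible_SL by (auto simp: GL_def)
  moreover have "embedded_submanifold (SL :: (real^'n^'n) set)"
    unfolding embedded_submanifold_def using slice_chart_SL_exists by blast
  ultimately show ?thesis
    unfolding semi_riemannian_manifold_def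
    by (intro conjI metric_tensor_trace_metric nondegenerate_trace_metric_SL)
qed

section \<open>Geodesics of the special linear group\<close>

text \<open>The derivative of \<open>Y\<close> in direction \<open>X p\<close> is taken along a
  curve in \<open>SL\<close> with velocity \<open>X p\<close>, where \<open>Y\<close> is tangent; so
  the covariant derivative is tangent and its normal part vanishes.\<close>

lemma second_fundamental_form_SL:
  fixes X Y :: "real^'n^'n \<Rightarrow> real^'n^'n"
  assumes N: "open N" and Y: "smooth_on N Y"
    and tan: "tangent_field (N \<inter> SL) X" "tangent_field (N \<inter> SL) Y" and p: "p \<in> N \<inter> SL"
  shows "second_fundamental_form SL trace_metric X Y p = 0"
proof -
  have pSL: "p \<in> SL"
    using p by simp
  have T: "tangent_space (N \<inter> SL) A = tangent_space SL A" if "A \<in> N \<inter> SL" for A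
    using that tangent_space_SL[OF N that] by (simp add: tangent_space_SL_UNIV)
  have "X p \<in> tangent_space (N \<inter> SL) p"
    using tan(1) p by (simp add: tangent_field_def)
  then obtain e \<gamma> where e: "e > 0" and \<gamma>: "\<gamma> ` {-e<..<e} \<subseteq> N \<inter> SL" "\<gamma> 0 = p"
    and der: "(\<gamma> has_vector_derivative X p) (at (0::real))"
    unfolding tangent_space_def by blast
  have "(Y has_derivative frechet_derivative Y (at p)) (at p)"
    using Y p by (intro Ck_on_has_derivative[of 0 N]) (auto simp only: smooth_on_open_iff[OF N])
  then have "((\<lambda>s. Y (\<gamma> s)) has_vector_derivative frechet_derivative Y (at p) (X p)) (at 0)"
    using has_vector_derivative_chain[OF der] \<gamma>(2) by simp
  moreover have "Y (\<gamma> s) \<in> tangent_space SL (\<gamma> s)" if "s \<in> {-e<..<e}" for s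
    using \<gamma>(1) that tan(2) T[of "\<gamma> s"] by (auto simp: tangent_field_def image_subset_iff)
  ultimately have "frechet_derivative Y (at p) (X p) + gl_christoffel p (X p) (Y p) \<in> tangent_space SL p"
    using tangent_covariant_derivative_SL[of "{-e<..<e}" 0 \<gamma> "X p" "\<lambda>s. Y (\<gamma> s)"] e \<gamma> der
    by auto
  then have "cov_deriv trace_metric X Y p \<in> tangent_space SL p"
    by (simp add: cov_deriv_def christoffel_trace_metric invertible_SL[OF pSL])
  moreover have "subspace (tangent_space SL p)"
    using pSL by (simp add: tangent_space_SL_UNIV subspace_trace_eq_0)
  ultimately show ?thesis
    unfolding second_fundamental_form_def
    using normal_part_eq_0[of SL p trace_metric] nondegenerate_trace_metric_SL[OF pSL] by blast
qed

lemma totally_geodesic_SL: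
  "totally_geodesic_submanifold (SL :: (real^'n^'n) set) GL trace_metric"
  unfolding totally_geodesic_submanifold_def semi_riemannian_submanifold_def
proof (intro conjI allI impI ballI)
  show "SL \<subseteq> (GL :: (real^'n^'n) set)"
    using invertible_SL by (auto simp: GL_def)
  fix N :: "(real^'n^'n) set" and X Y p
  assume "open N \<and> N \<subseteq> GL \<and> smooth_on N X \<and> smooth_on N Y \<and>
    tangent_field (N \<inter> SL) X \<and> tangent_field (N \<inter> SL) Y" "p \<in> N \<inter> SL"
  then show "second_fundamental_form SL trace_metric X Y p = 0"
    using second_fundamental_form_SL by blast
qed (simp_all add: open_GL semi_riemannian_manifold_GL semi_riemannian_manifold_SL)

text \<open>The Levi-Civita connection of a chart of \<open>SL\<close> is the pullback of the connection of \<open>GL\<close>: no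
  tangential projection is needed, since \<open>SL\<close> is totally geodesic.\<close>

lemma pullback_SL:
  fixes \<phi> \<psi> :: "real^'n^'n \<Rightarrow> real^'n^'n"
  assumes ch: "slice_chart SL H W V \<phi> \<psi>" and y: "y \<in> V" "y \<in> H"
  defines "D \<equiv> frechet_derivative \<psi> (at y)"
  defines "\<Gamma> \<equiv> \<lambda>u v. frechet_derivative \<phi> (at (\<psi> y))
    (second_derivative \<psi> y u v + gl_christoffel (\<psi> y) (D u) (D v))"
  shows "nondegenerate_form H (pullback_metric trace_metric \<psi> y)"
    and "levi_civita_form H (pullback_metric trace_metric \<psi>) y \<Gamma>"
proof -
  let ?h = "pullback_metric trace_metric \<psi>"
  note H = slice_chartD(1)[OF ch] and V = slice_chartD(3)[OF ch] and C2 = slice_chartD(5)[OF ch, of 2]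
  have ySL: "\<psi> y \<in> SL"
    using slice_chartD(11)[OF ch y(1)] y(2) by blast
  have DH: "D ` H = tangent_space SL (\<psi> y)"
    unfolding D_def by (rule slice_chart_tangent_space[OF ch y])
  have lin: "linear D"
    unfolding D_def using slice_chart_has_derivative(2)[OF ch y(1)] has_derivative_linear by blast
  have inv: "frechet_derivative \<phi> (at (\<psi> y)) (D u) = u" "D (frechet_derivative \<phi> (at (\<psi> y)) v) = v" for u v
    unfolding D_def by (rule slice_chart_derivative_inverse[OF ch y(1)])+
  have h: "?h y u v = trace_metric (\<psi> y) (D u) (D v)" for u v
    by (simp add: pullback_metric_def D_def)
  note nd = nondegenerate_trace_metric_SL[OF ySL]
  have "v = 0" if v: "v \<in> H" "\<forall>w\<in>H. ?h y v w = 0" for v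
  proof -
    have "D v = 0"
      by (rule nondegenerate_form_eq_0[OF nd[folded DH]]) (use v in \<open>auto simp: h\<close>)
    then show ?thesis
      using inv(1)[of v] inv(1)[of 0] linear_0[OF lin] by simp
  qed
  then show "nondegenerate_form H (?h y)"
    unfolding nondegenerate_form_def
    by (auto simp: h linear_add[OF lin] linear_scale[OF lin] trace_metric_simps
        intro: trace_metric_commute)
  have der: "((\<lambda>s. frechet_derivative \<psi> (at (y + s *\<^sub>R u)) v) has_vector_derivative
      second_derivative \<psi> y u v) (at 0)" for u v
    using has_vector_derivative_chain[OF has_vector_derivative_line[of y u 0],
        where f = "\<lambda>y. frechet_derivative \<psi> (at y) v"] Ck_on_2_derivatives(2)[OF C2 y(1), of v]
    by simp
  have der\<psi>: "((\<lambda>s. \<psi> (y + s *\<^sub>R u)) has_vector_derivative D u) (at 0)" for u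
    using has_vector_derivative_chain[OF has_vector_derivative_line, of \<psi> D y 0 u]
      slice_chart_has_derivative(2)[OF ch y(1)] by (simp add: D_def)
  \<comment> \<open>The images of \<open>v\<close> under the derivative of \<open>\<psi>\<close>
    form a tangent field along the image of the line in direction \<open>u\<close>; the expression
    is the covariant derivative of that field in \<open>GL\<close>.\<close>
  have tan: "second_derivative \<psi> y u v + gl_christoffel (\<psi> y) (D u) (D v) \<in> tangent_space SL (\<psi> y)"
    if uv: "u \<in> H" "v \<in> H" for u v
  proof -
    have line: "y + s *\<^sub>R u \<in> H" for s
      using H y(2) uv(1) by (simp add: subspace_add subspace_scale)
    have "frechet_derivative \<psi> (at (y + s *\<^sub>R u)) v \<in> tangent_space SL (\<psi> (y + s *\<^sub>R u))"
      and "\<psi> (y + s *\<^sub>R u) \<in> SL" if "y + s *\<^sub>R u \<in> V" for s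
      using slice_chart_tangent_space[OF ch that line] uv(2) slice_chartD(11)[OF ch that] line by auto
    then show ?thesis
      using tangent_covariant_derivative_SL[OF open_line[OF V, of y u] _ _ der\<psi>[of u] _ der[of u v]] y(1)
      by (simp add: D_def image_subset_iff)
  qed
  have D\<Gamma>: "D (\<Gamma> u v) = second_derivative \<psi> y u v + gl_christoffel (\<psi> y) (D u) (D v)" for u v
    by (simp add: \<Gamma>_def inv)
  show "levi_civita_form H ?h y \<Gamma>"
    unfolding levi_civita_form_def
  proof (intro conjI ballI)
    fix u v assume uv: "u \<in> H" "v \<in> H"
    obtain x where "x \<in> H" "second_derivative \<psi> y u v + gl_christoffel (\<psi> y) (D u) (D v) = D x"
      using tan[OF uv] DH by blast
    then show "\<Gamma> u v \<in> H"
      by (simp add: \<Gamma>_def inv)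
    show "\<Gamma> u v = \<Gamma> v u"
      by (simp add: \<Gamma>_def gl_christoffel_def add.commute
          second_derivative_symmetric[OF C2 V y(1), of u v])
    fix w
    \<comment> \<open>Compatibility in \<open>GL\<close> for the fields induced by \<open>v\<close>
      and \<open>w\<close> along the same curve; \<open>D\<Gamma>\<close> recognises their covariant
      derivatives as images of the candidate form.\<close>
    have "((\<lambda>s. ?h (y + s *\<^sub>R u) v w) has_real_derivative ?h y (\<Gamma> u v) w + ?h y v (\<Gamma> u w)) (at 0)"
      using has_real_derivative_trace_metric[OF der\<psi>[of u] _ der[of u v] der[of u w]] invertible_SL[OF ySL]
      unfolding h D\<Gamma> by (simp add: pullback_metric_def D_def)
    then show "deriv (\<lambda>s. ?h (y + s *\<^sub>R u) v w) 0 = ?h y (\<Gamma> u v) w + ?h y v (\<Gamma> u w)"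
      by (rule DERIV_imp_deriv)
  qed
qed

text \<open>Applying the injective map \<open>D\<close> to the chart equation turns the second
  derivative of \<open>\<psi>\<close> inside the Christoffel form, together with
  \<open>D c2\<close>, into the acceleration of \<open>\<gamma>\<close>. What remains is free of the
  chart.\<close>

lemma geodesic_equation_SL:
  fixes \<gamma> :: "real \<Rightarrow> real^'n^'n"
  assumes ch: "slice_chart SL H W V \<phi> \<psi>"
    and I: "open I" "t \<in> I" and \<gamma>: "Ck_on 2 I \<gamma>" "\<gamma> ` I \<subseteq> SL" "\<gamma> t \<in> W"
  shows "geodesic_equation_at H (pullback_metric trace_metric \<psi>) (\<phi> \<circ> \<gamma>) t \<longleftrightarrow>
    vector_derivative (\<lambda>s. vector_derivative \<gamma> (at s)) (at t) =
      vector_derivative \<gamma> (at t) ** matrix_inv (\<gamma> t) ** vector_derivative \<gamma> (at t)"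
proof -
  define y where "y = \<phi> (\<gamma> t)"
  define c1 where "c1 = vector_derivative (\<phi> \<circ> \<gamma>) (at t)"
  define c2 where "c2 = vector_derivative (\<lambda>s. vector_derivative (\<phi> \<circ> \<gamma>) (at s)) (at t)"
  define D where "D = frechet_derivative \<psi> (at y)"
  define E where "E = frechet_derivative \<phi> (at (\<psi> y))"
  let ?g1 = "vector_derivative \<gamma> (at t)"
  let ?g2 = "vector_derivative (\<lambda>s. vector_derivative \<gamma> (at s)) (at t)"
  note curve = slice_chart_curve[OF ch I \<gamma>, folded c1_def c2_def, unfolded comp_apply, folded y_def D_def]
  have \<psi>y: "\<psi> y = \<gamma> t" and y: "y \<in> V" "y \<in> H"
    using slice_chartD(6,7)[OF ch \<gamma>(3)] slice_chartD(10)[OF ch \<gamma>(3)] \<gamma>(2) I(2) by (auto simp: y_def)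
  have inv: "E (D u) = u" "D (E v) = v" for u v
    unfolding D_def E_def by (rule slice_chart_derivative_inverse[OF ch y(1)])+
  have lin: "linear D"
    unfolding D_def using slice_chart_has_derivative(2)[OF ch y(1)] has_derivative_linear by blast
  have g2: "?g2 = second_derivative \<psi> y c1 c1 + D c2"
    unfolding D_def by (rule curve(4)[unfolded D_def])
  have "christoffel H (pullback_metric trace_metric \<psi>) y c1 c1 =
      E (second_derivative \<psi> y c1 c1 + gl_christoffel (\<gamma> t) ?g1 ?g1)"
    using christoffel_eq[OF slice_chartD(1)[OF ch] pullback_SL[OF ch y] curve(1,1)]
    by (simp add: E_def D_def curve(3) \<psi>y)
  then have "geodesic_equation_at H (pullback_metric trace_metric \<psi>) (\<phi> \<circ> \<gamma>) t \<longleftrightarrow>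
      c2 + E (second_derivative \<psi> y c1 c1 + gl_christoffel (\<gamma> t) ?g1 ?g1) = 0"
    by (simp add: geodesic_equation_at_def flip: c1_def c2_def y_def)
  also have "\<dots> \<longleftrightarrow> D (c2 + E (second_derivative \<psi> y c1 c1 + gl_christoffel (\<gamma> t) ?g1 ?g1)) = 0"
    using inv(1) linear_0[OF lin] by metis
  also have "\<dots> \<longleftrightarrow> ?g2 + gl_christoffel (\<gamma> t) ?g1 ?g1 = 0"
    by (simp add: linear_add[OF lin] inv(2) g2 add_ac)
  also have "gl_christoffel (\<gamma> t) ?g1 ?g1 = - (?g1 ** matrix_inv (\<gamma> t) ** ?g1)"
    by (simp add: gl_christoffel_def flip: scaleR_2)
  finally show ?thesis
    by (simp only: add_uminus_conv_diff right_minus_eq)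
qed

text \<open>The definition asks for some chart at each time; since the matrix equation is the same
  in all of them, any chart supplied by \<open>slice_chart_SL_exists\<close> serves the
  converse.\<close>

lemma geodesic_SL_iff:
  fixes \<gamma> :: "real \<Rightarrow> real^'n^'n"
  shows "geodesic SL trace_metric I \<gamma> \<longleftrightarrow>
    open I \<and> is_interval I \<and> I \<noteq> {} \<and> smooth_on I \<gamma> \<and> \<gamma> ` I \<subseteq> SL \<and>
    (\<forall>t\<in>I. vector_derivative (\<lambda>s. vector_derivative \<gamma> (at s)) (at t) =
      vector_derivative \<gamma> (at t) ** matrix_inv (\<gamma> t) ** vector_derivative \<gamma> (at t))"
    (is "_ \<longleftrightarrow> ?R")
proof
  assume g: "geodesic SL trace_metric I \<gamma>"
  then have I: "open I" "\<gamma> ` I \<subseteq> SL" and \<gamma>: "Ck_on 2 I \<gamma>"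
    by (auto simp: geodesic_def smooth_on_open_iff)
  have "vector_derivative (\<lambda>s. vector_derivative \<gamma> (at s)) (at t) =
      vector_derivative \<gamma> (at t) ** matrix_inv (\<gamma> t) ** vector_derivative \<gamma> (at t)" if t: "t \<in> I" for t
  proof -
    obtain H W V \<phi> \<psi> where ch: "slice_chart SL H W V \<phi> \<psi>" "\<gamma> t \<in> W"
      and eq: "geodesic_equation_at H (pullback_metric trace_metric \<psi>) (\<phi> \<circ> \<gamma>) t"
      using g t unfolding geodesic_def by meson
    show ?thesis
      by (rule iffD1[OF geodesic_equation_SL[OF ch(1) I(1) t \<gamma> I(2) ch(2)] eq])
  qed
  then show ?R
    using g by (simp add: geodesic_def)
next
  assume R: ?R
  then have I: "open I" "\<gamma> ` I \<subseteq> SL" and \<gamma>: "Ck_on 2 I \<gamma>"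
    by (auto simp: smooth_on_open_iff)
  have "\<exists>H W V \<phi> \<psi>. slice_chart SL H W V \<phi> \<psi> \<and> \<gamma> t \<in> W \<and>
      geodesic_equation_at H (pullback_metric trace_metric \<psi>) (\<phi> \<circ> \<gamma>) t" if t: "t \<in> I" for t
  proof -
    have "\<gamma> t \<in> SL"
      using I(2) t by blast
    then obtain H W V \<phi> \<psi> where ch: "slice_chart SL H W V \<phi> \<psi>" "\<gamma> t \<in> W"
      using slice_chart_SL_exists by meson
    have "geodesic_equation_at H (pullback_metric trace_metric \<psi>) (\<phi> \<circ> \<gamma>) t"
      using geodesic_equation_SL[OF ch(1) I(1) t \<gamma> I(2) ch(2)] R t by simp
    then show ?thesis
      using ch by metis
  qed
  then show "geodesic SL trace_metric I \<gamma>"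
    using R by (simp add: geodesic_def)
qed

lemma geodesic_matrix_exp:
  fixes K C :: "real^'n^'n"
  assumes K: "det K = 1" and C: "trace C = 0"
  shows "geodesic SL trace_metric UNIV (\<lambda>t. K ** matrix_exp (t *\<^sub>R C))"
proof -
  let ?P = "\<lambda>t. K ** matrix_exp (t *\<^sub>R C)"
  have P: "(?P has_vector_derivative ?P t ** C) (at t)" for t
    using has_vector_derivative_matrix_mult[OF has_vector_derivative_const[of K]
        has_vector_derivative_matrix_exp[of C t]]
    by (simp add: matrix_exp_commute matrix_mul_assoc)
  have P1: "vector_derivative ?P (at t) = ?P t ** C" for t
    by (rule vector_derivative_at[OF P])
  have "((\<lambda>t. ?P t ** C) has_vector_derivative ?P t ** C ** C) (at t)" for t
    using has_vector_derivative_matrix_mult[OF P has_vector_derivative_const[of C]] by simp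
  note P2 = vector_derivative_at[OF this]
  have SL: "?P t \<in> SL" for t
    by (simp add: SL_def det_mul K det_matrix_exp[OF C])
  have "B ** C ** C = B ** C ** matrix_inv B ** (B ** C)" if "invertible B" for B :: "real^'n^'n"
    using that by (simp add: matrix_mul_assoc)
  from this[OF invertible_SL[OF SL]]
  have "?P t ** C ** C = ?P t ** C ** matrix_inv (?P t) ** (?P t ** C)" for t .
  then show ?thesis
    unfolding geodesic_SL_iff P1 P2 using SL
    by (auto simp: smooth_on_open_iff Ck_on_matrix_exp)
qed

lemma geodesic_SL_imp_matrix_exp:
  fixes \<gamma> :: "real \<Rightarrow> real^'n^'n"
  assumes g: "geodesic SL trace_metric I \<gamma>"
  obtains K C where "det K = 1" "trace C = 0" "\<And>t. t \<in> I \<Longrightarrow> \<gamma> t = K ** matrix_exp (t *\<^sub>R C)"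
proof -
  let ?d = "\<lambda>s. vector_derivative \<gamma> (at s)"
  have I: "open I" "convex I" "I \<noteq> {}" and \<gamma>: "Ck_on 2 I \<gamma>" "\<gamma> ` I \<subseteq> SL"
    and eq: "\<And>t. t \<in> I \<Longrightarrow> vector_derivative ?d (at t) = ?d t ** matrix_inv (\<gamma> t) ** ?d t"
    using g by (auto simp: geodesic_SL_iff smooth_on_open_iff is_interval_convex)
  obtain t0 where t0: "t0 \<in> I"
    using I(3) by blast
  have inv: "invertible (\<gamma> t)" if "t \<in> I" for t
    using \<gamma>(2) that invertible_SL by blast
  note d1 = Ck_on_vector_derivative[OF I(1) \<gamma>(1)[unfolded numeral_2_eq_2]]
  note d2 = Ck_on_vector_derivative(1)[OF I(1) d1(2)]
  \<comment> \<open>With P for the curve, the derivative is P^-1 (P'' - P' P^-1 P'), which the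
    geodesic equation makes zero.\<close>
  have "((\<lambda>s. matrix_inv (\<gamma> s) ** ?d s) has_vector_derivative 0) (at t within I)" if t: "t \<in> I" for t
    using has_vector_derivative_at_within[OF has_vector_derivative_matrix_mult[OF
          has_vector_derivative_matrix_inv[OF d1(1)[OF t] inv[OF t]] d2[OF t]], of I]
    by (simp add: eq[OF t] matrix_mul_assoc matrix_mult_linear_simps)
  then obtain C where C: "\<And>t. t \<in> I \<Longrightarrow> matrix_inv (\<gamma> t) ** ?d t = C"
    using has_vector_derivative_zero_constant[OF I(2)] by blast
  have d: "?d t = \<gamma> t ** C" if t: "t \<in> I" for t
    using inv[OF t] by (simp add: matrix_mul_assoc flip: C[OF t])
  have "((\<lambda>s. det (\<gamma> s)) has_vector_derivative trace C) (at t0)"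
    using has_real_derivative_det[OF d1(1)[OF t0] inv[OF t0]] \<gamma>(2) t0 C[OF t0]
    by (auto simp: SL_def has_real_derivative_iff_has_vector_derivative)
  then have "((\<lambda>s. 1) has_vector_derivative trace C) (at t0)"
    by (rule has_vector_derivative_transform_within_open[OF _ I(1) t0])
      (use \<gamma>(2) in \<open>auto simp: SL_def\<close>)
  then have tr: "trace C = 0"
    using vector_derivative_unique_at[OF _ has_vector_derivative_const] by blast
  \<comment> \<open>Variation of constants for P' = P C. The interval may omit 0, so
    \<open>K\<close> is obtained as this constant value instead of as the value at time 0.\<close>
  have "((\<lambda>s. \<gamma> s ** matrix_exp (s *\<^sub>R (- C))) has_vector_derivative 0) (at t within I)"
    if t: "t \<in> I" for t
    using has_vector_derivative_at_within[OF has_vector_derivative_matrix_mult[OF d1(1)[OF t]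
          has_vector_derivative_matrix_exp[of "- C" t]], of I]
    by (simp add: d[OF t] matrix_mul_assoc matrix_mult_linear_simps)
  then obtain K where K: "\<And>t. t \<in> I \<Longrightarrow> \<gamma> t ** matrix_exp (t *\<^sub>R (- C)) = K"
    using has_vector_derivative_zero_constant[OF I(2)] by blast
  have \<gamma>K: "\<gamma> t = K ** matrix_exp (t *\<^sub>R C)" if t: "t \<in> I" for t
    by (simp add: matrix_exp_minus flip: K[OF t] matrix_mul_assoc)
  moreover have "det K = 1"
    using \<gamma>(2) t0 \<gamma>K[OF t0] by (auto simp: SL_def det_mul det_matrix_exp[OF tr])
  ultimately show ?thesis
    using that tr by blast
qed

text \<open>The exponential curve extends any geodesic to the whole line, so maximality forces
  \<open>I = UNIV\<close>; conversely a geodesic on \<open>UNIV\<close> has no room for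
  extension.\<close>

lemma maximal_geodesic_SL_iff:
  fixes P :: "real \<Rightarrow> real^'n^'n"
  shows "maximal_geodesic SL trace_metric I P \<longleftrightarrow>
    I = UNIV \<and> (\<exists>K C. det K = 1 \<and> trace C = 0 \<and> (\<forall>t. P t = K ** matrix_exp (t *\<^sub>R C)))"
proof
  assume P: "maximal_geodesic SL trace_metric I P"
  then have "geodesic SL trace_metric I P"
    by (simp add: maximal_geodesic_def)
  then obtain K C where KC: "det K = 1" "trace C = 0" "\<And>t. t \<in> I \<Longrightarrow> P t = K ** matrix_exp (t *\<^sub>R C)"
    by (rule geodesic_SL_imp_matrix_exp) blast
  have "UNIV = I"
    using P geodesic_matrix_exp[OF KC(1,2)] KC(3) unfolding maximal_geodesic_def by auto
  then show "I = UNIV \<and> (\<exists>K C. det K = 1 \<and> trace C = 0 \<and> (\<forall>t. P t = K ** matrix_exp (t *\<^sub>R C)))"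
    using KC by blast
next
  assume "I = UNIV \<and> (\<exists>K C. det K = 1 \<and> trace C = 0 \<and> (\<forall>t. P t = K ** matrix_exp (t *\<^sub>R C)))"
  then obtain K C where "I = UNIV" "det K = 1" "trace C = 0" "P = (\<lambda>t. K ** matrix_exp (t *\<^sub>R C))"
    by blast
  then show "maximal_geodesic SL trace_metric I P"
    by (auto simp: maximal_geodesic_def geodesic_matrix_exp)
qed

theorem proposition4p2:
  "totally_geodesic_submanifold (SL :: (real^'n^'n) set) GL trace_metric \<and>
   (\<forall>I (P :: real \<Rightarrow> real^'n^'n).
      maximal_geodesic SL trace_metric I P \<longleftrightarrow>
      I = UNIV \<and>
      (\<exists>K C. det K = 1 \<and> trace C = 0 \<and> (\<forall>t. P t = K ** matrix_exp (t *\<^sub>R C)))) \<and>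
   geodesically_complete (SL :: (real^'n^'n) set) trace_metric"
  using totally_geodesic_SL maximal_geodesic_SL_iff
  unfolding geodesically_complete_def by blast

end
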